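(* Let $\zeta=(\theta,\rho)$ be a rational critical point. If $\rho\neq0,1$, then $\zeta$ is an interior point of the dominant curves of $\zeta$, and the common Farey point of four infinite pencils of curves, arranged pairwise as adjacent curves in two pencils of chains of opposite sign. Furthermore, all Farey points distinct from $\zeta$ in a pencil (that is, the Farey points other than $\zeta$ of the curves of that pencil) belong to (the closure of) a dominant curve of a neighbour of $\zeta$, this association between pencils and dominant curves of neighbours being bi-unique (one-to-one). The same applies if $\rho=0,1$, but in this case one neighbour and two pencils are missing (three pencils, if $\theta=0,1$).
   Context: Rotation and coding. For $(\theta,\rho)\in[0,1]^2$ let $g:[0,1)\to[0,1)$, $x\mapsto\{x+\theta\}$ ($\{\cdot\}$ = fractional part), with the partition $I_a=[0,\rho)$, $I_b=[\rho,1)$, which codes each orbit by letters $a,b$. In phase space the values $\theta=1$, $\rho=1$ are represented by their fractional part $0$. Critical points. $(\theta,\rho)\in[0,1]^2$ is a critical point if $i\theta=j+\rho$ for some $(i,j)\in\mathbb{Z}^2$. A rational critical point is a critical point with rational coordinates; it has the form $\zeta=(p/q,r/s)$ (fractions in lowest terms) with $s$ dividing $q$. Its upper and lower neighbours are $\zeta+(0,1/q)$ and $\zeta-(0,1/q)$, which are also critical points; the lower one is missing if $\rho=0$ and the upper one is missing if $\rho=1$. Chains. For $(i,j)\in\mathbb{Z}^2$ with $0\leqslant j\leqslant i-1$ if $i>0$, $-1\leqslant j\leqslant 0$ if $i=0$, $i\leqslant j\leqslant -1$ if $i<0$, the chain with affine parameters $(i,j)$ is the segment $\mathcal{L}_{i,j}=\{(\theta,\rho)\in[0,1]^2: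 \rho=i\theta-j\}$. In particular $\mathcal{L}_{0,0}$ is the segment $\rho=0$ and $\mathcal{L}_{0,-1}$ the segment $\rho=1$. A chain is positive if $i>0$, negative if $i<0$; for $i=0$ it is both. Critical words. The critical word at a point $(\theta,\rho)$ of $\mathcal{L}_{i,j}$ is: the empty word if $\rho\in\{0,1\}$; if $\rho\neq0,1$ and $i>0$, the symbol sequence of the orbit starting at $0$ up to, but excluding, its first visit to $\rho$; if $\rho\neq 0,1$ and $i<0$, the symbol sequence of the orbit starting at $\rho$ up to, but excluding, its first visit to $0$. Critical curves and Farey points. For a point $\zeta$ of a chain, the critical curve on the chain containing $\zeta$ is the set of points of the chain sharing the same critical word; if this set reduces to a point, it is called a Farey point of the chain. The two end-points of a chain with $i\neq0$ (where $\rho=0$ and $\rho=1$) count as two separate Farey points. Thus a chain with $i\ne0$ is partitioned into finitely many critical curves, which are open segments, separated by Farey points, while $\mathcal{L}_{0,0}$ and $\mathcal{L}_{0,-1}$ each consist of a single critical curve and have no Farey points. The Farey points of a critical curve are those belonging to the closure of the curve; a curve is adjacent to a Farey point if its closure contains it. Dominant objects. Let $\zeta=(p/q,\rho)$ be a rational critical point. If $\rho\neq0,1$, its positive dominant chain is the chain $\mathcal L_{i,j}$ through $\zeta$ with $i>0$ minimal, and its negative dominant chain is the chain $\mathcal L_{i,j}$ through $\zeta$ with $i<0$ and $-i$ minimal. If $\rho=0$, the positive dominant chain is $\mathcal{L}_{0,0}$ and the negative one is $\mathcal{L}_{-q,-p}$; if $\rho=1$, the positive one is $\mathcal{L}_{q,p-1}$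 and the negative one is $\mathcal{L}_{0,-1}$ (for $q=1$, a pair not satisfying the bounds above defines no chain and is disregarded). The dominant curves of $\zeta$ are the critical curves on its dominant chains that contain $\zeta$ or, where $\zeta$ is an end-point of the dominant chain ($\mathcal{L}_{-q,-p}$ for $\rho=0$, $\mathcal{L}_{q,p-1}$ for $\rho=1$), the critical curve of that chain adjacent to $\zeta$. Pencils. Consider the four quadrants with origin at $\zeta$. The pencil of curves of $\zeta$ in a given quadrant is the family of critical curves lying in that quadrant that belong to non-dominant chains through $\zeta$ and are adjacent to $\zeta$. The first and third quadrants contain the curves of positive chains, the second and fourth those of negative chains.
   Formalization: If a neighbour of an inner ζ has ρ=0,1, two pencils share its horizontal curve (e.g. ζ=(1/2,1/2)), so it is counted once per sign; for ρ=0,1, ζ is interior only to dominant curves whose chain does not end at ζ; at corners only uniqueness of the pencil's curve is claimed. *)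

theory Defs
  imports "HOL-Analysis.Analysis"
begin

type_synonym point = "real \<times> real"

(* A chain is represented by its affine parameters (i, j). *)
type_synonym chain = "int \<times> int"

datatype letter = La | Lb

datatype chain_sign = Positive | Negative

datatype quadrant_name = Q1 | Q2 | Q3 | Q4


definition rotation :: "real \<Rightarrow> real \<Rightarrow> real" where
  "rotation \<theta> x = frac (x + \<theta>)"

definition code :: "real \<Rightarrow> real \<Rightarrow> letter" where
  "code \<rho> x = (if x < \<rho> then La else Lb)"

definition itinerary :: "real \<Rightarrow> real \<Rightarrow> real \<Rightarrow> real \<Rightarrow> letter list" where
  "itinerary \<theta> \<rho> x y =
     map (\<lambda>n. code \<rho> ((rotation \<theta> ^^ n) x)) [0..<(LEAST n. (rotation \<theta> ^^ n) x = y)]"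


definition critical_point :: "point \<Rightarrow> bool" where
  "critical_point z \<longleftrightarrow> fst z \<in> {0..1} \<and> snd z \<in> {0..1} \<and>
     (\<exists>i j :: int. of_int i * fst z = of_int j + snd z)"

definition rational_critical_point :: "point \<Rightarrow> bool" where
  "rational_critical_point z \<longleftrightarrow> critical_point z \<and> fst z \<in> \<rat> \<and> snd z \<in> \<rat>"

(* For rational x = p/q in lowest terms, with q > 0, this is the pair (p, q). *)
definition lowest_terms :: "real \<Rightarrow> int \<times> int" where
  "lowest_terms x = quotient_of (inv real_of_rat x)"

definition num :: "real \<Rightarrow> int" where
  "num x = fst (lowest_terms x)"

definition den :: "real \<Rightarrow> int" where
  "den x = snd (lowest_terms x)"

definition neighbours :: "point \<Rightarrow> point set" where
  "neighbours z =
     {w. snd z \<noteq> 1 \<and> w = z + (0, 1 / of_int (den (fst z)))} \<union>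
     {w. snd z \<noteq> 0 \<and> w = z - (0, 1 / of_int (den (fst z)))}"


definition is_chain :: "chain \<Rightarrow> bool" where
  "is_chain c \<longleftrightarrow> (case c of (i, j) \<Rightarrow>
     (i > 0 \<and> 0 \<le> j \<and> j \<le> i - 1) \<or>
     (i = 0 \<and> -1 \<le> j \<and> j \<le> 0) \<or>
     (i < 0 \<and> i \<le> j \<and> j \<le> -1))"

definition segment :: "chain \<Rightarrow> point set" where
  "segment c = {(\<theta>, \<rho>). \<theta> \<in> {0..1} \<and> \<rho> \<in> {0..1} \<and> \<rho> = of_int (fst c) * \<theta> - of_int (snd c)}"

(* The horizontal chains (i = 0) have both signs; consequently the horizontal dominant curve of a
   point with \<rho> = 0 or \<rho> = 1 counts once as positive and once as negative. *)
definition chain_has_sign :: "chain_sign \<Rightarrow> chain \<Rightarrow> bool" where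
  "chain_has_sign s c \<longleftrightarrow> (case s of Positive \<Rightarrow> fst c \<ge> 0 | Negative \<Rightarrow> fst c \<le> 0)"

definition end_point :: "chain \<Rightarrow> point \<Rightarrow> bool" where
  "end_point c z \<longleftrightarrow> fst c \<noteq> 0 \<and> z \<in> segment c \<and> snd z \<in> {0, 1}"

definition critical_word :: "chain \<Rightarrow> point \<Rightarrow> letter list" where
  "critical_word c z = (case z of (\<theta>, \<rho>) \<Rightarrow>
     if \<rho> = 0 \<or> \<rho> = 1 then []
     else if fst c > 0 then itinerary \<theta> \<rho> 0 \<rho>
     else itinerary \<theta> \<rho> \<rho> 0)"

(* Both end-points of a chain with i \<noteq> 0 have the empty word, but are kept apart. *)
definition word_class :: "chain \<Rightarrow> point \<Rightarrow> point set" where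
  "word_class c z =
     (if end_point c z then {z}
      else {w \<in> segment c. critical_word c w = critical_word c z})"

definition farey_point :: "chain \<Rightarrow> point \<Rightarrow> bool" where
  "farey_point c z \<longleftrightarrow> z \<in> segment c \<and> word_class c z = {z}"

definition critical_curves :: "chain \<Rightarrow> point set set" where
  "critical_curves c = {word_class c z | z. z \<in> segment c \<and> \<not> farey_point c z}"

definition curve_farey_points :: "chain \<Rightarrow> point set \<Rightarrow> point set" where
  "curve_farey_points c C = {w. farey_point c w \<and> w \<in> closure C}"


definition dominant_chain :: "chain_sign \<Rightarrow> point \<Rightarrow> chain \<Rightarrow> bool" where
  "dominant_chain s z c \<longleftrightarrow> is_chain c \<and>
     (if snd z = 0 then
        c = (case s of Positive \<Rightarrow> (0, 0) | Negative \<Rightarrow> (- den (fst z), - num (fst z)))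
      else if snd z = 1 then
        c = (case s of Positive \<Rightarrow> (den (fst z), num (fst z) - 1) | Negative \<Rightarrow> (0, -1))
      else
        z \<in> segment c \<and> fst c \<noteq> 0 \<and> chain_has_sign s c \<and>
        (\<forall>c'. is_chain c' \<and> z \<in> segment c' \<and> fst c' \<noteq> 0 \<and> chain_has_sign s c'
              \<longrightarrow> \<bar>fst c\<bar> \<le> \<bar>fst c'\<bar>))"

definition dominant_curves_on :: "point \<Rightarrow> chain \<Rightarrow> point set set" where
  "dominant_curves_on z c =
     {C \<in> critical_curves c. if end_point c z then z \<in> closure C else z \<in> C}"

definition dominant_curves_of :: "chain_sign \<Rightarrow> point \<Rightarrow> point set set" where
  "dominant_curves_of s z = {C. \<exists>c. dominant_chain s z c \<and> C \<in> dominant_curves_on z c}"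

definition dominant_curves :: "point \<Rightarrow> point set set" where
  "dominant_curves z = (\<Union>s. dominant_curves_of s z)"

definition nondominant_chains :: "point \<Rightarrow> chain set" where
  "nondominant_chains z = {c. is_chain c \<and> z \<in> segment c \<and> (\<forall>s. \<not> dominant_chain s z c)}"


definition quadrant :: "quadrant_name \<Rightarrow> point \<Rightarrow> point set" where
  "quadrant Q z = (case Q of
      Q1 \<Rightarrow> {w. fst w \<ge> fst z \<and> snd w \<ge> snd z}
    | Q2 \<Rightarrow> {w. fst w \<le> fst z \<and> snd w \<ge> snd z}
    | Q3 \<Rightarrow> {w. fst w \<le> fst z \<and> snd w \<le> snd z}
    | Q4 \<Rightarrow> {w. fst w \<ge> fst z \<and> snd w \<le> snd z})"

definition quadrant_sign :: "quadrant_name \<Rightarrow> chain_sign" where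
  "quadrant_sign Q = (if Q = Q1 \<or> Q = Q3 then Positive else Negative)"

definition adjacent_curves :: "point \<Rightarrow> chain \<Rightarrow> point set set" where
  "adjacent_curves z c = {C \<in> critical_curves c. z \<in> closure C}"

definition pencil :: "point \<Rightarrow> quadrant_name \<Rightarrow> point set set" where
  "pencil z Q =
     {C. C \<subseteq> quadrant Q z \<and> (\<exists>c \<in> nondominant_chains z. C \<in> adjacent_curves z c)}"

(* The pencils of z that are not missing. *)
definition pencil_quadrants :: "point \<Rightarrow> quadrant_name set" where
  "pencil_quadrants z = {Q. pencil z Q \<noteq> {}}"

definition pencil_farey_points :: "point \<Rightarrow> quadrant_name \<Rightarrow> point set" where
  "pencil_farey_points z Q =
     (\<Union>c \<in> nondominant_chains z. \<Union>C \<in> critical_curves c \<inter> pencil z Q.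
        curve_farey_points c C) - {z}"

definition pencil_in_curve :: "point \<Rightarrow> quadrant_name \<Rightarrow> point set \<Rightarrow> bool" where
  "pencil_in_curve z Q C \<longleftrightarrow> pencil_farey_points z Q \<subseteq> closure C"

end

(* Let c = (i, j) be a chain with i \<noteq> 0 and put I = |i|. At abscissa \<theta>, letter number n of the
   critical word tells whether adding the fractional parts of n\<theta> and (I - n)\<theta> produces a carry.
   Equal words therefore give equal sums floor(n\<theta>) + floor((I - n)\<theta>), and as each floor is
   monotone in \<theta>, each summand agrees. So two points of c have the same word iff no fraction with
   denominator at most I lies in the closed interval between their abscissas: the Farey points of c
   sit over these fractions, the curves over the gaps.

   Let \<zeta> = (p/q, k/q). A chain through \<zeta> of order I < q is dominant, and one of order I \<ge> q has a
   Farey point at \<zeta>. In the latter case the curve leaving \<zeta> in the horizontal direction e = 1 or -1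
   ends at the abscissa u/v with uq - pv = e and I - q < v \<le> I. If d is the vertical direction of the
   curve, this end lies on the line through (p/q, (k + d)/q) of slope de(I - v). Now 0 \<le> I - v < q,
   and de(I - v)p is congruent to k + d modulo q, so I - v depends only on the quadrant: the whole
   pencil ends on one line, which carries a dominant chain of the neighbour (p/q, (k + d)/q). Finally,
   fractions strictly between p/q and u/v have denominator at least q + v > I - v, so no Farey point
   of that chain separates the neighbour from these ends, and they lie on a single dominant curve. *)

theory Submission
  imports Defs
begin

section \<open>Critical words along a chain\<close>

text \<open>The comparison of words meets one obstacle: a word may stop early, at its first visit,
  and then has fewer than \<open>I\<close> letters. The last letter before the visit settles this:
  two distinct points of a chain, other than its end-points, never share such a short word. A shared
  word thus has full length and controls all floors.

  The edges of the unit square shape the rest. Writing every ordinate over the denominator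
  \<open>q\<close> turns the neighbours into instances of the same setting, with \<open>k\<close>
  replaced by \<open>k + 1\<close> or \<open>k - 1\<close>, and a pencil exists as soon as the unit
  steps \<open>k + d\<close> and \<open>p + e\<close> stay between 0 and \<open>q\<close>. If a
  neighbour has ordinate 0 or 1, then \<open>I - v = 0\<close>, and all pencils pointing to it end
  on one horizontal chain; the pairing is therefore made with signs, and a horizontal curve may
  serve twice.

  Uniqueness of the curve rests on two far ends of a pencil with different abscissas: two such
  points fix the chain, and two points in the closure of a gap fix the gap.\<close>

definition fractions_upto :: "nat \<Rightarrow> real set" where
  "fractions_upto I = {x. \<exists>m\<in>{1..I}. real m * x \<in> \<int>}"

text \<open>For 0 < \<rho> < 1, the orbit of 0 on a positive chain is at
  \<open>frac (n * \<theta>)\<close> after \<open>n\<close> steps, with target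
  \<open>frac (I * \<theta>)\<close>; the orbit of \<rho> on a negative chain is at
  \<open>frac (- ((I - n) * \<theta>))\<close>, with target 0. Both arrive exactly when
  \<open>(I - n) * \<theta>\<close> is an integer, so one formula gives the length of either word.
  The value \<open>n = I\<close> always qualifies.\<close>

definition first_visit :: "nat \<Rightarrow> real \<Rightarrow> nat" where
  "first_visit I x = (LEAST n. (real I - real n) * x \<in> \<int>)"

definition chain_point :: "chain \<Rightarrow> real \<Rightarrow> point" where
  "chain_point c x = (x, of_int (fst c) * x - of_int (snd c))"

abbreviation chain_order :: "chain \<Rightarrow> nat" where
  "chain_order c \<equiv> nat \<bar>fst c\<bar>"

lemma frac_eq_iff_diff_Ints: "frac x = frac y \<longleftrightarrow> x - y \<in> \<int>" for x y :: real
proof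
  assume "frac x = frac y"
  then have "x - y = of_int (\<lfloor>x\<rfloor> - \<lfloor>y\<rfloor>)" by (simp add: frac_def)
  then show "x - y \<in> \<int>" by (metis Ints_of_int)
next
  assume "x - y \<in> \<int>"
  then obtain n where "x = y + of_int n" by (metis Ints_cases add.commute diff_add_cancel)
  then show "frac x = frac y" by (simp add: frac_def)
qed

lemma funpow_rotation:
  assumes "0 \<le> x" "x < 1"
  shows "(rotation \<theta> ^^ n) x = frac (x + real n * \<theta>)"
proof (induction n)
  case 0
  then show ?case using assms by (simp add: frac_eq)
next
  case (Suc n)
  have "frac (frac (x + real n * \<theta>) + \<theta>) = frac (x + real (Suc n) * \<theta>)"
    unfolding frac_eq_iff_diff_Ints by (simp add: frac_def algebra_simps)
  with Suc show ?case by (simp add: rotation_def)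
qed

text \<open>A carry subtracts 1 from \<open>frac x + frac y\<close>, which leaves less than
  \<open>frac x\<close>; without a carry the fractional part cannot drop. With
  \<open>x = n * \<theta>\<close> and \<open>x + y = I * \<theta>\<close> the right-hand side is the
  comparison that defines a letter on a positive chain.\<close>

lemma floor_add_eq_iff_frac_le: "\<lfloor>x\<rfloor> + \<lfloor>y\<rfloor> = \<lfloor>x + y\<rfloor> \<longleftrightarrow> frac x \<le> frac (x + y)" for x y :: real
proof -
  have "frac (x + y) = frac x + (frac y + of_int (\<lfloor>x\<rfloor> + \<lfloor>y\<rfloor> - \<lfloor>x + y\<rfloor>))"
    by (simp add: frac_def)
  moreover have "\<lfloor>x\<rfloor> + \<lfloor>y\<rfloor> = \<lfloor>x + y\<rfloor> \<or> \<lfloor>x\<rfloor> + \<lfloor>y\<rfloor> - \<lfloor>x + y\<rfloor> \<le> - 1"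
    using le_floor_add[of x y] by linarith
  moreover have "0 \<le> frac y" "frac y < 1" by (auto simp: frac_lt_1)
  ultimately show ?thesis
  proof (elim disjE)
    assume "\<lfloor>x\<rfloor> + \<lfloor>y\<rfloor> - \<lfloor>x + y\<rfloor> \<le> - 1"
    moreover from this have "real_of_int (\<lfloor>x\<rfloor> + \<lfloor>y\<rfloor> - \<lfloor>x + y\<rfloor>) \<le> - 1"
      by (metis of_int_le_iff of_int_minus of_int_1)
    ultimately show ?thesis
      using \<open>frac (x + y) = _\<close> \<open>frac y < 1\<close> by auto
  qed simp
qed

lemma first_visit_le: "first_visit I x \<le> I"
  unfolding first_visit_def by (rule Least_le) simp

lemma first_visit_Ints: "(real I - real (first_visit I x)) * x \<in> \<int>"
  unfolding first_visit_def by (rule LeastI[of _ I]) simp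

lemma not_Ints_before_first_visit: "n < first_visit I x \<Longrightarrow> (real I - real n) * x \<notin> \<int>"
  unfolding first_visit_def by (rule not_less_Least)

lemma first_visit_eq_iff: "first_visit I x = I \<longleftrightarrow> x \<notin> fractions_upto I"
proof
  assume *: "first_visit I x = I"
  show "x \<notin> fractions_upto I"
  proof
    assume "x \<in> fractions_upto I"
    then obtain m where m: "m \<in> {1..I}" "real m * x \<in> \<int>" by (auto simp: fractions_upto_def)
    then have "(real I - real (I - m)) * x \<in> \<int>" by (simp add: of_nat_diff)
    moreover have "I - m < first_visit I x" using m * by auto
    ultimately show False using not_Ints_before_first_visit by blast
  qed
next
  assume *: "x \<notin> fractions_upto I"
  show "first_visit I x = I"
  proof (rule ccontr)
    assume "first_visit I x \<noteq> I"
    then have lt: "first_visit I x < I" using first_visit_le[of I x] by simp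
    have "real (I - first_visit I x) * x \<in> \<int>"
      using first_visit_Ints[of I x] lt by (simp add: of_nat_diff)
    with lt * show False unfolding fractions_upto_def
      by (auto dest!: bspec[of _ _ "I - first_visit I x"])
  qed
qed

text \<open>The test \<open>= (fst c > 0)\<close> exchanges the letters on negative chains: there
  the orbit point is \<open>1 - frac ((I - n) * \<theta>)\<close> and \<rho> is
  \<open>1 - frac (I * \<theta>)\<close>, which reverses the inequality. Restricting
  \<open>n\<close> to steps before the visit excludes integral \<open>(I - n) * \<theta>\<close>,
  where the comparisons would be off.\<close>

lemma critical_word_eq:
  assumes c: "fst c \<noteq> 0" and z: "(\<theta>, \<rho>) \<in> segment c" "\<rho> \<notin> {0, 1}"
  shows "critical_word c (\<theta>, \<rho>) =
    map (\<lambda>n. if (\<lfloor>real n * \<theta>\<rfloor> + \<lfloor>(real (chain_order c) - real n) * \<theta>\<rfloor> = \<lfloor>real (chain_order c) * \<theta>\<rfloor>)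
                  = (fst c > 0) then La else Lb) [0..<first_visit (chain_order c) \<theta>]"
proof -
  define I where "I = chain_order c"
  let ?I = "real I"
  have rho: "\<rho> = of_int (fst c) * \<theta> - of_int (snd c)" "0 < \<rho>" "\<rho> < 1"
    using z by (auto simp: segment_def)
  have split: "real n * \<theta> + (?I - real n) * \<theta> = ?I * \<theta>" for n by (simp add: algebra_simps)
  show ?thesis
  proof (cases "fst c > 0")
    case True
    have I: "of_int (fst c) = ?I" using True by (simp add: I_def)
    have fr: "frac (?I * \<theta>) = \<rho>"
      unfolding frac_unique_iff using rho I by simp
    have orb: "(rotation \<theta> ^^ n) 0 = frac (real n * \<theta>)" for n
      by (simp add: funpow_rotation)
    have visit: "(rotation \<theta> ^^ n) 0 = \<rho> \<longleftrightarrow> (?I - real n) * \<theta> \<in> \<int>" for n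
    proof -
      have "frac (?I * \<theta>) = frac (real n * \<theta>) \<longleftrightarrow> (?I - real n) * \<theta> \<in> \<int>"
        unfolding frac_eq_iff_diff_Ints by (simp add: algebra_simps)
      then show ?thesis using orb fr by auto
    qed
    have "critical_word c (\<theta>, \<rho>) = map (\<lambda>n. code \<rho> (frac (real n * \<theta>))) [0..<first_visit I \<theta>]"
      using z True unfolding critical_word_def prod.case itinerary_def visit first_visit_def unfolding orb by simp
    also have "\<dots> = map (\<lambda>n. if (\<lfloor>real n * \<theta>\<rfloor> + \<lfloor>(?I - real n) * \<theta>\<rfloor> = \<lfloor>?I * \<theta>\<rfloor>)
                  = (fst c > 0) then La else Lb) [0..<first_visit I \<theta>]"
    proof (rule map_cong[OF refl])
      fix n assume "n \<in> set [0..<first_visit I \<theta>]"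
      then have "(?I - real n) * \<theta> \<notin> \<int>" using not_Ints_before_first_visit by auto
      then have "frac (real n * \<theta>) \<noteq> \<rho>" using visit orb by metis
      then have "frac (real n * \<theta>) < \<rho> \<longleftrightarrow> \<lfloor>real n * \<theta>\<rfloor> + \<lfloor>(?I - real n) * \<theta>\<rfloor> = \<lfloor>?I * \<theta>\<rfloor>"
        using floor_add_eq_iff_frac_le[of "real n * \<theta>" "(?I - real n) * \<theta>"] fr split by auto
      then show "code \<rho> (frac (real n * \<theta>)) = (if (\<lfloor>real n * \<theta>\<rfloor> + \<lfloor>(?I - real n) * \<theta>\<rfloor> = \<lfloor>?I * \<theta>\<rfloor>)
                  = (fst c > 0) then La else Lb)"
        using True by (simp add: code_def)
    qed
    finally show ?thesis unfolding I_def .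
  next
    case False
    have I: "of_int (fst c) = - ?I" using False c by (simp add: I_def)
    have fr: "frac (?I * \<theta>) = 1 - \<rho>"
    proof -
      have "?I * \<theta> - (1 - \<rho>) = of_int (- snd c - 1)" using rho I by simp
      then show ?thesis unfolding frac_unique_iff using rho by (simp del: of_int_diff)
    qed
    have orb: "(rotation \<theta> ^^ n) \<rho> = frac (- ((?I - real n) * \<theta>))" for n
    proof -
      have "\<rho> + real n * \<theta> - - ((?I - real n) * \<theta>) = of_int (- snd c)"
        using rho I by (simp add: algebra_simps)
      then have "frac (\<rho> + real n * \<theta>) = frac (- ((?I - real n) * \<theta>))"
        unfolding frac_eq_iff_diff_Ints by (metis Ints_of_int)
      then show ?thesis using rho by (simp add: funpow_rotation)
    qed
    have visit: "(rotation \<theta> ^^ n) \<rho> = 0 \<longleftrightarrow> (?I - real n) * \<theta> \<in> \<int>" for n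
      by (simp only: orb frac_eq_0_iff Ints_minus) (metis Ints_minus minus_minus)
    have "critical_word c (\<theta>, \<rho>) = map (\<lambda>n. code \<rho> (frac (- ((?I - real n) * \<theta>)))) [0..<first_visit I \<theta>]"
      using z False unfolding critical_word_def prod.case itinerary_def visit first_visit_def unfolding orb by simp
    also have "\<dots> = map (\<lambda>n. if (\<lfloor>real n * \<theta>\<rfloor> + \<lfloor>(?I - real n) * \<theta>\<rfloor> = \<lfloor>?I * \<theta>\<rfloor>)
                  = (fst c > 0) then La else Lb) [0..<first_visit I \<theta>]"
    proof (rule map_cong[OF refl])
      fix n assume "n \<in> set [0..<first_visit I \<theta>]"
      then have "(?I - real n) * \<theta> \<notin> \<int>" using not_Ints_before_first_visit by auto
      then have "frac (- ((?I - real n) * \<theta>)) = 1 - frac ((?I - real n) * \<theta>)" by (simp add: frac_neg)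
      then have "frac (- ((?I - real n) * \<theta>)) < \<rho> \<longleftrightarrow> \<not> (frac ((?I - real n) * \<theta>) \<le> frac (?I * \<theta>))"
        using fr by auto
      also have "\<dots> \<longleftrightarrow> \<not> (\<lfloor>real n * \<theta>\<rfloor> + \<lfloor>(?I - real n) * \<theta>\<rfloor> = \<lfloor>?I * \<theta>\<rfloor>)"
        using floor_add_eq_iff_frac_le[of "(?I - real n) * \<theta>" "real n * \<theta>"] split
        by (simp add: add.commute)
      finally show "code \<rho> (frac (- ((?I - real n) * \<theta>))) = (if (\<lfloor>real n * \<theta>\<rfloor> + \<lfloor>(?I - real n) * \<theta>\<rfloor> = \<lfloor>?I * \<theta>\<rfloor>)
                  = (fst c > 0) then La else Lb)"
        using False by (simp add: code_def)
    qed
    finally show ?thesis unfolding I_def .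
  qed
qed

text \<open>If the floor of the \<open>m\<close>-fold multiple grows between \<open>x\<close> and
  \<open>y\<close>, its final value divided by \<open>m\<close> is a fraction in the closed
  interval.\<close>

lemma floor_mult_eq_if_no_fraction:
  assumes "x \<le> y" "{x..y} \<inter> fractions_upto I = {}" "m \<le> I"
  shows "\<lfloor>real m * x\<rfloor> = \<lfloor>real m * y\<rfloor>"
proof (cases "m = 0")
  case False
  show ?thesis
  proof (rule ccontr)
    assume "\<lfloor>real m * x\<rfloor> \<noteq> \<lfloor>real m * y\<rfloor>"
    moreover have "\<lfloor>real m * x\<rfloor> \<le> \<lfloor>real m * y\<rfloor>"
      using assms(1) by (intro floor_mono mult_left_mono) auto
    ultimately have *: "\<lfloor>real m * x\<rfloor> < \<lfloor>real m * y\<rfloor>" by simp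
    define t where "t = of_int \<lfloor>real m * y\<rfloor> / real m"
    have "t \<le> y" unfolding t_def using False by (simp add: field_simps)
    moreover have "real m * x < of_int \<lfloor>real m * y\<rfloor>" using * by linarith
    then have "x \<le> t" unfolding t_def using False by (simp add: field_simps)
    moreover have "real m * t = of_int \<lfloor>real m * y\<rfloor>" unfolding t_def using False by simp
    then have "t \<in> fractions_upto I"
      unfolding fractions_upto_def using assms(3) False by (auto intro!: bexI[of _ m])
    ultimately show False using assms(2) by auto
  qed
qed simp

text \<open>Floors detect a fraction in (x, y], but not one at \<open>x\<close> itself, where the
  jump has already happened; the point \<open>x\<close> is therefore excluded by hypothesis.\<close>

lemma no_fraction_if_floor_mult_eq:
  assumes "x \<le> y" "x \<notin> fractions_upto I" "\<And>m. m \<le> I \<Longrightarrow> \<lfloor>real m * x\<rfloor> = \<lfloor>real m * y\<rfloor>"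
  shows "{x..y} \<inter> fractions_upto I = {}"
proof (rule ccontr)
  assume "{x..y} \<inter> fractions_upto I \<noteq> {}"
  then obtain t where "x \<le> t" "t \<le> y" "t \<in> fractions_upto I" by auto
  then obtain m where t: "x \<le> t" "t \<le> y" "m \<in> {1..I}" "real m * t \<in> \<int>"
    by (auto simp: fractions_upto_def)
  then obtain k where k: "real m * t = of_int k" by (auto elim: Ints_cases)
  have "real m * t \<le> real m * y" using t by (intro mult_left_mono) auto
  then have "k \<le> \<lfloor>real m * x\<rfloor>" using k assms(3)[of m] t(3) by (simp add: le_floor_iff)
  then have "of_int k \<le> real m * x" by (simp add: le_floor_iff)
  moreover have "real m * x \<le> real m * t" using t by (intro mult_left_mono) auto
  ultimately have "real m * x = of_int k" using k by simp
  then have "x \<in> fractions_upto I" unfolding fractions_upto_def using t(3) Ints_of_int by (metis (mono_tags, lifting) mem_Collect_eq)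
  with assms(2) show False by simp
qed

lemma critical_word_eqD:
  assumes c: "fst c \<noteq> 0"
    and x: "(x, r) \<in> segment c" "r \<notin> {0, 1}" and y: "(y, s) \<in> segment c" "s \<notin> {0, 1}"
    and w: "critical_word c (x, r) = critical_word c (y, s)" and xy: "x < y"
  shows "{x..y} \<inter> fractions_upto (chain_order c) = {}"
proof -
  define I where "I = chain_order c"
  define N where "N = first_visit I x"
  let ?s = "\<lambda>x n. \<lfloor>real n * x\<rfloor> + \<lfloor>(real I - real n) * x\<rfloor>"
  have wx: "critical_word c (x, r) = map (\<lambda>n. if (?s x n = \<lfloor>real I * x\<rfloor>) = (fst c > 0) then La else Lb) [0..<N]"
    using critical_word_eq[OF c x] by (simp add: I_def N_def)
  have wy: "critical_word c (y, s) = map (\<lambda>n. if (?s y n = \<lfloor>real I * y\<rfloor>) = (fst c > 0) then La else Lb) [0..<first_visit I y]"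
    using critical_word_eq[OF c y] by (simp add: I_def)
  have Ny: "first_visit I y = N" using arg_cong[OF w, of length] unfolding wx wy by simp
  have NI: "N \<le> I" unfolding N_def by (rule first_visit_le)
  have rs: "0 < r" "r < 1" "0 < s" "s < 1" "r = of_int (fst c) * x - of_int (snd c)"
    "s = of_int (fst c) * y - of_int (snd c)" "0 \<le> x" "y \<le> 1"
    using x y by (auto simp: segment_def)
  \<comment> \<open>The height stays strictly between 0 and 1 in the interior of a chain, so the
    integer part of \<open>I * \<theta>\<close> is fixed there by \<open>snd c\<close> and the
    sign.\<close>
  have flI: "\<lfloor>real I * x\<rfloor> = \<lfloor>real I * y\<rfloor> \<and> real I * x \<notin> \<int>"
  proof (cases "fst c > 0")
    case True
    then have "real I = of_int (fst c)" by (simp add: I_def)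
    then have "real I * x = r + of_int (snd c)" "real I * y = s + of_int (snd c)" using rs by simp_all
    then have "\<lfloor>real I * x\<rfloor> = snd c" "\<lfloor>real I * y\<rfloor> = snd c" "real I * x \<noteq> of_int (snd c)" using rs by linarith+
    then show ?thesis by (metis Ints_cases floor_of_int)
  next
    case False
    then have "real I = - of_int (fst c)" using c by (simp add: I_def)
    then have "real I * x = of_int (- snd c) - r" "real I * y = of_int (- snd c) - s" using rs by simp_all
    then have "\<lfloor>real I * x\<rfloor> = - snd c - 1" "\<lfloor>real I * y\<rfloor> = - snd c - 1" "real I * x \<noteq> of_int (- snd c - 1)" using rs by linarith+
    then show ?thesis by (metis Ints_cases floor_of_int)
  qed
  have mono: "\<lfloor>real n * x\<rfloor> \<le> \<lfloor>real n * y\<rfloor>" "n \<le> I \<Longrightarrow> \<lfloor>(real I - real n) * x\<rfloor> \<le> \<lfloor>(real I - real n) * y\<rfloor>" for n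
    using xy by (auto intro!: floor_mono mult_left_mono)
  have fl: "\<lfloor>real n * x\<rfloor> = \<lfloor>real n * y\<rfloor> \<and> \<lfloor>(real I - real n) * x\<rfloor> = \<lfloor>(real I - real n) * y\<rfloor>" if n: "n < N" for n
  proof -
    have "(if (?s x n = \<lfloor>real I * x\<rfloor>) = (fst c > 0) then La else Lb) = (if (?s y n = \<lfloor>real I * y\<rfloor>) = (fst c > 0) then La else Lb)"
      using w n unfolding wx wy Ny by (auto simp: map_eq_conv simp del: of_nat_diff split: if_splits)
    then have *: "(?s x n = \<lfloor>real I * x\<rfloor>) = (?s y n = \<lfloor>real I * y\<rfloor>)" by (auto split: if_splits)
    \<comment> \<open>A sum of two floors falls short of the floor of the sum by 0 or 1. Since the
      latter is the same at both points, a letter determines the value of \<open>?s\<close>.\<close>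
    have bd: "?s z n \<le> \<lfloor>real I * z\<rfloor> \<and> \<lfloor>real I * z\<rfloor> \<le> ?s z n + 1" for z
    proof -
      have "real n * z + (real I - real n) * z = real I * z" by (simp add: algebra_simps)
      then show ?thesis
        by linarith
    qed
    have "?s x n = ?s y n" using * bd[of x] bd[of y] flI by linarith
    then show ?thesis using mono[of n] n NI by linarith
  qed
  \<comment> \<open>For \<open>N < I\<close> both visits make \<open>(I - N) x\<close> and
    \<open>(I - N) y\<close> integers, and the last letter forces these integers to be equal, hence
    \<open>x = y\<close>.\<close>
  have "N = I"
  proof (rule ccontr)
    assume "N \<noteq> I"
    then have lt: "N < I" using NI by simp
    have "N \<noteq> 0" using first_visit_Ints[of I x, folded N_def] flI by (intro notI) simp
    then have f1: "\<lfloor>(real I - real (N - 1)) * x\<rfloor> = \<lfloor>(real I - real (N - 1)) * y\<rfloor>" using fl[of "N - 1"] by simp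
    obtain k l where kl: "(real I - real N) * x = of_int k" "(real I - real N) * y = of_int l"
      using first_visit_Ints[of I x] first_visit_Ints[of I y] Ny unfolding N_def by (auto elim!: Ints_cases)
    \<comment> \<open>The letter before the visit compares \<open>(I - N + 1) x\<close>, which exceeds the integer \<open>(I - N) x\<close> by \<open>x < 1\<close>.\<close>
    have "y \<noteq> 1"
      using first_visit_Ints[of I y] \<open>N \<noteq> 0\<close> not_Ints_before_first_visit[of 0 I y] Ny by auto
    then have "y < 1" using rs by simp
    have "(real I - real (N - 1)) * x = of_int k + x" "(real I - real (N - 1)) * y = of_int l + y"
      using kl \<open>N \<noteq> 0\<close> by (auto simp: algebra_simps of_nat_diff)
    then have "\<lfloor>of_int k + x\<rfloor> = \<lfloor>of_int l + y\<rfloor>" using f1 by simp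
    moreover have "\<lfloor>of_int k + x\<rfloor> = k" "\<lfloor>of_int l + y\<rfloor> = l"
      using rs xy \<open>y < 1\<close> by (intro floor_unique; simp)+
    ultimately have "k = l" by simp
    then have "(real I - real N) * x = (real I - real N) * y" using kl by simp
    then show False using lt xy by simp
  qed
  then have "x \<notin> fractions_upto I" using first_visit_eq_iff unfolding N_def by blast
  \<comment> \<open>The letters supply the floors for multipliers below \<open>I\<close>; the
    multiplier \<open>I\<close> itself is covered by \<open>flI\<close>.\<close>
  then have "{x..y} \<inter> fractions_upto I = {}"
    using fl flI xy \<open>N = I\<close> by (intro no_fraction_if_floor_mult_eq) (auto simp: le_less)
  then show ?thesis by (simp add: I_def)
qed

text \<open>Away from the fractions no visit occurs before step \<open>I\<close>, so both words have
  length \<open>I\<close>, and every floor entering the letters is constant on the interval.\<close>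

lemma critical_word_eqI:
  assumes c: "fst c \<noteq> 0"
    and x: "(x, r) \<in> segment c" "r \<notin> {0, 1}" and y: "(y, s) \<in> segment c" "s \<notin> {0, 1}"
    and xy: "x \<le> y" and none: "{x..y} \<inter> fractions_upto (chain_order c) = {}"
  shows "critical_word c (x, r) = critical_word c (y, s)"
proof -
  have "first_visit (chain_order c) x = chain_order c" "first_visit (chain_order c) y = chain_order c"
    unfolding first_visit_eq_iff using xy none by auto
  moreover have "\<lfloor>real m * x\<rfloor> = \<lfloor>real m * y\<rfloor>" if "m \<le> chain_order c" for m
    using floor_mult_eq_if_no_fraction[OF xy none that] .
  moreover from this have "\<lfloor>(real (chain_order c) - real n) * x\<rfloor> = \<lfloor>(real (chain_order c) - real n) * y\<rfloor>"
    if "n \<le> chain_order c" for n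
    using that by (metis diff_le_self of_nat_diff)
  ultimately show ?thesis
    unfolding critical_word_eq[OF c x] critical_word_eq[OF c y]
    by (auto simp del: of_nat_nat nat_abs_int_diff)
qed

section \<open>Critical curves as gaps between fractions\<close>

text \<open>Consecutive terms of the Farey sequence of order \<open>I\<close>, continued over the
  whole real line. Since the sequence is not cut off at 0 and 1, every point that is not a fraction
  has a gap around it, with no boundary cases.\<close>

definition fraction_gap :: "nat \<Rightarrow> real \<Rightarrow> real \<Rightarrow> bool" where
  "fraction_gap I a b \<longleftrightarrow> a < b \<and> a \<in> fractions_upto I \<and> b \<in> fractions_upto I \<and> {a<..<b} \<inter> fractions_upto I = {}"

lemma fractions_upto_uminus: "x \<in> fractions_upto I \<Longrightarrow> - x \<in> fractions_upto I"
  by (auto simp: fractions_upto_def)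

lemma fractions_uptoI: "of_int k * x \<in> \<int> \<Longrightarrow> k \<noteq> 0 \<Longrightarrow> nat \<bar>k\<bar> \<le> I \<Longrightarrow> x \<in> fractions_upto I"
  unfolding fractions_upto_def
  by (intro CollectI bexI[of _ "nat \<bar>k\<bar>"]) (auto simp: abs_if split: if_splits)

text \<open>For each \<open>m\<close> the largest multiple of \<open>1 / m\<close> below
  \<open>x\<close> is the floor of \<open>m * x\<close> divided by \<open>m\<close>; the maximum of
  these finitely many candidates is the wanted fraction.\<close>

lemma fraction_below:
  assumes "x \<notin> fractions_upto I" "I > 0"
  obtains a where "a < x" "a \<in> fractions_upto I" "{a<..<x} \<inter> fractions_upto I = {}"
proof -
  define A where "A = (\<lambda>m. of_int \<lfloor>real m * x\<rfloor> / real m) ` {1..I}"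
  have fin: "finite A" "A \<noteq> {}" using assms(2) by (auto simp: A_def)
  have A: "y \<in> fractions_upto I \<and> y < x" if "y \<in> A" for y
  proof -
    obtain m where m: "m \<in> {1..I}" "y = of_int \<lfloor>real m * x\<rfloor> / real m" using \<open>y \<in> A\<close> unfolding A_def by blast
    then have "real m * y \<in> \<int>" by simp
    then have y: "y \<in> fractions_upto I" using m(1) by (auto simp: fractions_upto_def)
    moreover have "real m * y \<le> real m * x" using m by simp
    then have "y \<le> x" using m(1) by simp
    ultimately show ?thesis using assms(1) by (metis le_less)
  qed
  have "\<not> (Max A < t \<and> t < x \<and> t \<in> fractions_upto I)" for t
  proof
    assume t: "Max A < t \<and> t < x \<and> t \<in> fractions_upto I"
    then obtain m where m: "m \<in> {1..I}" "real m * t \<in> \<int>" by (auto simp: fractions_upto_def)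
    then obtain k where k: "real m * t = of_int k" by (auto elim: Ints_cases)
    have "real m * t \<le> real m * x" using t by (intro mult_left_mono) auto
    then have "k \<le> \<lfloor>real m * x\<rfloor>" using k by (simp add: le_floor_iff)
    then have "t \<le> of_int \<lfloor>real m * x\<rfloor> / real m" using k m(1) by (simp add: field_simps)
    also have "\<dots> \<le> Max A" using fin m(1) by (intro Max_ge) (auto simp: A_def)
    finally show False using t by simp
  qed
  then have "{Max A<..<x} \<inter> fractions_upto I = {}" by auto
  then show ?thesis using that[of "Max A"] A[OF Max_in[OF fin]] by simp
qed

text \<open>The upper end comes from the lower one at \<open>- x\<close>, as the fractions are
  symmetric about 0.\<close>

lemma fraction_gap_around:
  assumes "x \<notin> fractions_upto I" "I > 0"
  obtains a b where "fraction_gap I a b" "a < x" "x < b"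
proof -
  obtain a where a: "a < x" "a \<in> fractions_upto I" "{a<..<x} \<inter> fractions_upto I = {}"
    using fraction_below assms by blast
  have "- x \<notin> fractions_upto I" using assms(1) fractions_upto_uminus[of "- x"] by auto
  then obtain b where b: "b < - x" "b \<in> fractions_upto I" "{b<..<- x} \<inter> fractions_upto I = {}"
    using fraction_below assms(2) by blast
  have "t \<notin> fractions_upto I" if "a < t" "t < - b" for t
  proof (cases t x rule: linorder_cases)
    case greater
    then have "- t \<in> {b<..<- x}" using that by auto
    then show ?thesis using b(3) fractions_upto_uminus by blast
  qed (use a(3) that assms(1) in auto)
  then have "fraction_gap I a (- b)"
    using a b fractions_upto_uminus[OF b(2)] by (auto simp: fraction_gap_def)
  then show ?thesis using that a(1) b(1) by auto
qed

lemma fraction_gap_unique: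
  assumes "fraction_gap I a b" "fraction_gap I a' b'" "a < b'" "a' < b"
  shows "a = a'" "b = b'"
proof -
  have *: "a' \<le> a \<and> b \<le> b'" if "fraction_gap I a b" "fraction_gap I a' b'" "a < b'" "a' < b" for a b a' b'
    using that unfolding fraction_gap_def by (metis disjoint_iff greaterThanLessThan_iff not_le)
  show "a = a'" "b = b'" using *[OF assms] *[OF assms(2,1,4,3)] by auto
qed

section \<open>Chains parametrised by the abscissa\<close>

lemma fst_chain_point [simp]: "fst (chain_point c x) = x"
  and snd_chain_point [simp]: "snd (chain_point c x) = of_int (fst c) * x - of_int (snd c)"
  by (simp_all add: chain_point_def)

lemma chain_point_inject [simp]: "chain_point c x = chain_point c y \<longleftrightarrow> x = y"
  by (auto simp: chain_point_def)

lemma chain_point_in_segment_iff: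
  "chain_point c x \<in> segment c \<longleftrightarrow> x \<in> {0..1} \<and> of_int (fst c) * x - of_int (snd c) \<in> {0..1}"
  by (simp add: segment_def chain_point_def)

lemma chain_point_image_open: "a \<le> b \<Longrightarrow> chain_point c ` {a<..<b} = open_segment (chain_point c a) (chain_point c b)"
  and chain_point_image_closed: "a \<le> b \<Longrightarrow> chain_point c ` {a..b} = closed_segment (chain_point c a) (chain_point c b)"
proof -
  have *: "(1 - u) *\<^sub>R chain_point c a + u *\<^sub>R chain_point c b = chain_point c ((1 - u) * a + u * b)" for u
    by (simp add: chain_point_def algebra_simps)
  show "chain_point c ` {a<..<b} = open_segment (chain_point c a) (chain_point c b)" if "a \<le> b"
  proof -
    have "{a<..<b} = open_segment a b" using that by (simp add: open_segment_eq_real_ivl)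
    then show ?thesis by (simp add: open_segment_image_interval image_image *)
  qed
  show "chain_point c ` {a..b} = closed_segment (chain_point c a) (chain_point c b)" if "a \<le> b"
  proof -
    have "{a..b} = closed_segment a b" using that by (simp add: closed_segment_eq_real_ivl)
    then show ?thesis by (simp add: closed_segment_image_interval image_image *)
  qed
qed

lemma closure_chain_point_image: "a < b \<Longrightarrow> closure (chain_point c ` {a<..<b}) = chain_point c ` {a..b}"
  by (simp add: chain_point_image_open chain_point_image_closed)

text \<open>\<open>chain_point c\<close> is affine: a linear map followed by a vertical translation.
  Relative interior is the notion needed here, because a curve has empty interior in the
  plane.\<close>

lemma rel_interior_chain_point_image:
  assumes "convex S"
  shows "rel_interior (chain_point c ` S) = chain_point c ` rel_interior S"
proof -
  define f :: "real \<Rightarrow> point" where "f x = (x, of_int (fst c) * x)" for x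
  have "linear f" by (auto simp: linear_iff f_def algebra_simps)
  then have "rel_interior (f ` S) = f ` rel_interior S"
    using rel_interior_convex_linear_image assms by metis
  moreover have "chain_point c ` T = (+) (0, - of_int (snd c)) ` f ` T" for T
    by (auto simp: image_image chain_point_def f_def)
  ultimately show ?thesis by (simp add: rel_interior_translation)
qed

lemma convex_segment: "convex (segment c)"
proof -
  have "segment c = {z. snd z = of_int (fst c) * fst z - of_int (snd c)} \<inter> ({0..1} \<times> {0..1})"
    by (auto simp: segment_def)
  moreover have "convex {z :: point. snd z = of_int (fst c) * fst z - of_int (snd c)}"
  proof -
    have "{z :: point. snd z = of_int (fst c) * fst z - of_int (snd c)} = {z. (of_int (fst c), - 1) \<bullet> z = of_int (snd c)}"
      by (auto simp: inner_prod_def)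
    then show ?thesis by (simp add: convex_hyperplane)
  qed
  ultimately show ?thesis by (auto intro!: convex_Int convex_Times)
qed

lemma chain_point_segment_between:
  assumes "chain_point c a \<in> segment c" "chain_point c b \<in> segment c" "a \<le> x" "x \<le> b"
  shows "chain_point c x \<in> segment c"
proof -
  have "chain_point c x \<in> closed_segment (chain_point c a) (chain_point c b)"
    using assms chain_point_image_closed[of a b c] by auto
  then show ?thesis using convex_segment assms(1,2) by (meson closed_segment_subset subsetD)
qed

lemma segment_eqD: "z \<in> segment c \<Longrightarrow> z = chain_point c (fst z)"
  by (auto simp: segment_def chain_point_def)

lemma end_of_chain_in_fractions:
  assumes "fst c \<noteq> 0" "of_int (fst c) * x - of_int (snd c) \<in> \<int>"
  shows "x \<in> fractions_upto (chain_order c)"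
proof -
  have "of_int (fst c) * x \<in> \<int>" using assms(2) by (metis Ints_add Ints_of_int diff_add_cancel)
  then show ?thesis using assms(1) by (intro fractions_uptoI) auto
qed

lemma Ints_in_fractions: "x \<in> \<int> \<Longrightarrow> I > 0 \<Longrightarrow> x \<in> fractions_upto I"
  by (intro fractions_uptoI[of 1]) auto

text \<open>A chain can leave the unit square only at abscissa 0 or 1 or at an integral height, and
  all these abscissas are fractions of order at most \<open>chain_order c\<close>. A gap that meets
  the chain in an inner point therefore lies in it together with its ends.\<close>

lemma gap_in_segment:
  assumes c: "fst c \<noteq> 0" and g: "fraction_gap (chain_order c) a b"
    and x: "a < x" "x < b" "chain_point c x \<in> segment c" and y: "a \<le> y" "y \<le> b"
  shows "chain_point c y \<in> segment c"
proof -
  have none: "t \<notin> fractions_upto (chain_order c)" if "a < t" "t < b" for t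
    using g that by (auto simp: fraction_gap_def)
  define r where "r = (\<lambda>x. of_int (fst c) * x - of_int (snd c) :: real)"
  have x01: "0 \<le> x" "x \<le> 1" "0 \<le> r x" "r x \<le> 1" using x(3) by (auto simp: chain_point_in_segment_iff r_def)
  have "0 \<in> fractions_upto (chain_order c)" "1 \<in> fractions_upto (chain_order c)" using c by (auto intro: Ints_in_fractions)
  then have y01: "0 \<le> y" "y \<le> 1" using none x x01 y by (smt (verit))+
  \<comment> \<open>The inequalities are strict on the side of \<open>y\<close>, which may be an end
    of the gap, and weak on the side of \<open>x\<close>, which lies inside; so the crossing
    abscissa \<open>t\<close> is strictly inside the gap.\<close>
  have cross: False if "\<epsilon> \<in> \<int>" "(r x \<le> \<epsilon> \<and> \<epsilon> < r y) \<or> (r y < \<epsilon> \<and> \<epsilon> \<le> r x)" for \<epsilon>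
  proof -
    define t where "t = (\<epsilon> + of_int (snd c)) / of_int (fst c)"
    have rt: "r t = \<epsilon>" using c by (simp add: r_def t_def)
    have "(x \<le> t \<and> t < y) \<or> (y < t \<and> t \<le> x)"
    proof (cases "fst c > 0")
      case True
      then have "r u \<le> r v \<longleftrightarrow> u \<le> v" for u v by (simp add: r_def)
      then show ?thesis using that(2) rt by (meson not_le)
    next
      case False
      then have "r u \<le> r v \<longleftrightarrow> v \<le> u" for u v using c by (simp add: r_def)
      then show ?thesis using that(2) rt by (meson not_le)
    qed
    then have "a < t" "t < b" using x y by auto
    moreover have "t \<in> fractions_upto (chain_order c)"
      using c rt that(1) by (intro end_of_chain_in_fractions) (auto simp: r_def)
    ultimately show False using none by blast
  qed
  have "0 \<le> r y" using cross[of 0] x01 by (cases "0 \<le> r y") auto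
  moreover have "r y \<le> 1" using cross[of 1] x01 by (cases "r y \<le> 1") auto
  ultimately show ?thesis using y01 by (simp add: chain_point_in_segment_iff r_def)
qed

lemma word_class_eq_gap:
  assumes c: "fst c \<noteq> 0" and g: "fraction_gap (chain_order c) a b"
    and x: "a < x" "x < b" "chain_point c x \<in> segment c"
  shows "word_class c (chain_point c x) = chain_point c ` {a<..<b}"
proof -
  let ?F = "fractions_upto (chain_order c)"
  have none: "t \<notin> ?F" if "a < t" "t < b" for t
    using g that by (auto simp: fraction_gap_def)
  have inner: "snd (chain_point c y) \<notin> {0, 1}" if "y \<notin> ?F" for y
    using end_of_chain_in_fractions[OF c, of y] that by (metis Ints_0 Ints_1 empty_iff insert_iff snd_chain_point)
  have xs: "(x, snd (chain_point c x)) \<in> segment c" using x(3) by (simp add: chain_point_def)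
  have xF: "x \<notin> ?F" using none x by auto
  have "word_class c (chain_point c x) = {w \<in> segment c. critical_word c w = critical_word c (chain_point c x)}"
    using inner[OF xF] by (auto simp: word_class_def end_point_def)
  also have "\<dots> = chain_point c ` {a<..<b}"
  proof (intro subset_antisym subsetI)
    fix w assume "w \<in> chain_point c ` {a<..<b}"
    then obtain y where y: "w = chain_point c y" "a < y" "y < b" by auto
    have w: "w \<in> segment c" using gap_in_segment[OF c g x] y by auto
    then have ys: "(y, snd (chain_point c y)) \<in> segment c" using y by (simp add: chain_point_def)
    have yF: "y \<notin> ?F" using none y by auto
    have "critical_word c (y, snd (chain_point c y)) = critical_word c (x, snd (chain_point c x))"
    proof (cases "x \<le> y")
      case True
      then show ?thesis using critical_word_eqI[OF c xs inner[OF xF] ys inner[OF yF]] none x y by fastforce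
    next
      case False
      then show ?thesis using critical_word_eqI[OF c ys inner[OF yF] xs inner[OF xF]] none x y by fastforce
    qed
    then show "w \<in> {w \<in> segment c. critical_word c w = critical_word c (chain_point c x)}"
      using w y(1) by (simp add: chain_point_def)
  next
    fix w assume "w \<in> {w \<in> segment c. critical_word c w = critical_word c (chain_point c x)}"
    then have w: "w \<in> segment c" "critical_word c w = critical_word c (chain_point c x)" by auto
    define y where "y = fst w"
    have wy: "w = chain_point c y" using segment_eqD[OF w(1)] by (simp add: y_def)
    have ys: "(y, snd (chain_point c y)) \<in> segment c" using w wy by (simp add: chain_point_def)
    have eq: "critical_word c (y, snd (chain_point c y)) = critical_word c (x, snd (chain_point c x))"
      using w wy by (simp add: chain_point_def)
    \<comment> \<open>The common word has positive length, which excludes the end-points of the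
      chain, whose word is empty by convention.\<close>
    have "length (critical_word c (x, snd (chain_point c x))) = chain_order c"
      using critical_word_eq[OF c xs inner[OF xF]] xF first_visit_eq_iff by simp
    then have "critical_word c (y, snd (chain_point c y)) \<noteq> []" using c eq by auto
    then have yi: "snd (chain_point c y) \<notin> {0, 1}" by (auto simp: critical_word_def)
    have "a < y \<and> y < b"
    proof (cases x y rule: linorder_cases)
      case less
      then have "{x..y} \<inter> ?F = {}" using critical_word_eqD[OF c xs inner[OF xF] ys yi] eq by auto
      then have "b \<notin> {x..y}" using g by (auto simp: fraction_gap_def)
      then show ?thesis using less x by auto
    next
      case greater
      then have "{y..x} \<inter> ?F = {}" using critical_word_eqD[OF c ys yi xs inner[OF xF]] eq by auto
      then have "a \<notin> {y..x}" using g by (auto simp: fraction_gap_def)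
      then show ?thesis using greater x by auto
    qed (use x in auto)
    then show "w \<in> chain_point c ` {a<..<b}" using wy by auto
  qed
  finally show ?thesis .
qed

text \<open>If another point had the same word, the closed interval between the two abscissas would
  be free of fractions, yet it contains \<open>x\<close>.\<close>

lemma word_class_eq_singleton:
  assumes c: "fst c \<noteq> 0" and x: "chain_point c x \<in> segment c" "x \<in> fractions_upto (chain_order c)"
  shows "word_class c (chain_point c x) = {chain_point c x}"
proof (cases "end_point c (chain_point c x)")
  case False
  then have xi: "snd (chain_point c x) \<notin> {0, 1}" using x(1) c by (auto simp: end_point_def)
  have xs: "(x, snd (chain_point c x)) \<in> segment c" using x(1) by (simp add: chain_point_def)
  have "w = chain_point c x" if w: "w \<in> segment c" "critical_word c w = critical_word c (chain_point c x)" for w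
  proof -
    define y where "y = fst w"
    have wy: "w = chain_point c y" using segment_eqD[OF w(1)] by (simp add: y_def)
    have ys: "(y, snd (chain_point c y)) \<in> segment c" using w wy by (simp add: chain_point_def)
    have eq: "critical_word c (y, snd (chain_point c y)) = critical_word c (x, snd (chain_point c x))"
      using w wy by (simp add: chain_point_def)
    \<comment> \<open>A visit at time 0 would make the height an integer, but it lies strictly
      between 0 and 1. So the word is not empty and cannot be that of an end-point.\<close>
    have "first_visit (chain_order c) x \<noteq> 0"
    proof
      assume "first_visit (chain_order c) x = 0"
      then have "real (chain_order c) * x \<in> \<int>" using first_visit_Ints[of "chain_order c" x] by simp
      then have "of_int (fst c) * x \<in> \<int>" by (auto simp: abs_if split: if_splits)
      then obtain k where "of_int (fst c) * x = of_int k" by (auto elim: Ints_cases)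
      then have "snd (chain_point c x) = of_int (k - snd c)" by simp
      moreover have "0 < snd (chain_point c x)" "snd (chain_point c x) < 1"
        using xi x(1) by (auto simp: chain_point_in_segment_iff)
      ultimately show False by (metis of_int_0_less_iff of_int_less_1_iff zero_less_iff_neq_zero int_one_le_iff_zero_less not_le)
    qed
    then have "critical_word c (x, snd (chain_point c x)) \<noteq> []"
      using critical_word_eq[OF c xs xi] by simp
    then have yi: "snd (chain_point c y) \<notin> {0, 1}" using eq by (auto simp: critical_word_def)
    have "x = y"
    proof (cases x y rule: linorder_cases)
      case less
      then have "{x..y} \<inter> fractions_upto (chain_order c) = {}" using critical_word_eqD[OF c xs xi ys yi] eq by auto
      moreover have "x \<in> {x..y}" using less by simp
      ultimately show ?thesis using x by blast
    next
      case greater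
      then have "{y..x} \<inter> fractions_upto (chain_order c) = {}" using critical_word_eqD[OF c ys yi xs xi] eq by auto
      moreover have "x \<in> {y..x}" using greater by simp
      ultimately show ?thesis using x by blast
    qed
    then show ?thesis using wy by simp
  qed
  then show ?thesis using False x(1) by (auto simp: word_class_def)
qed (simp add: word_class_def)

lemma farey_point_iff:
  assumes c: "fst c \<noteq> 0"
  shows "farey_point c z \<longleftrightarrow> z \<in> segment c \<and> fst z \<in> fractions_upto (chain_order c)"
proof (cases "z \<in> segment c")
  case True
  define x where "x = fst z"
  have z: "z = chain_point c x" using segment_eqD[OF True] by (simp add: x_def)
  show ?thesis
  proof (cases "x \<in> fractions_upto (chain_order c)")
    case True
    then show ?thesis using word_class_eq_singleton[OF c] z by (auto simp: farey_point_def)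
  next
    case False
    then obtain a b where ab: "fraction_gap (chain_order c) a b" "a < x" "x < b"
      using fraction_gap_around c by (metis abs_ge_zero abs_zero gr0I int_nat_eq nat_eq_iff2 abs_eq_0 of_nat_0)
    then have "word_class c z = chain_point c ` {a<..<b}" using word_class_eq_gap[OF c] True z by auto
    moreover obtain y where "x < y" "y < b" using ab dense by blast
    then have "chain_point c y \<in> chain_point c ` {a<..<b}" "chain_point c y \<noteq> z" using ab z by auto
    ultimately have "word_class c z \<noteq> {z}" by blast
    then show ?thesis using False z by (auto simp: farey_point_def)
  qed
qed (simp add: farey_point_def)

text \<open>Together with \<open>farey_point_iff\<close> this removes words from all later arguments
  about chains that are not horizontal: only gaps of the Farey sequence of order
  \<open>chain_order c\<close> remain.\<close>

lemma critical_curves_iff: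
  assumes c: "fst c \<noteq> 0"
  shows "C \<in> critical_curves c \<longleftrightarrow> (\<exists>a b. fraction_gap (chain_order c) a b \<and>
    chain_point c a \<in> segment c \<and> chain_point c b \<in> segment c \<and> C = chain_point c ` {a<..<b})"
proof
  assume "C \<in> critical_curves c"
  then obtain z where z: "C = word_class c z" "z \<in> segment c" "\<not> farey_point c z"
    by (auto simp: critical_curves_def)
  define x where "x = fst z"
  have zx: "z = chain_point c x" using segment_eqD[OF z(2)] by (simp add: x_def)
  have "x \<notin> fractions_upto (chain_order c)" using z farey_point_iff[OF c] x_def by auto
  then obtain a b where ab: "fraction_gap (chain_order c) a b" "a < x" "x < b"
    using fraction_gap_around[of x "chain_order c"] c by auto
  have x: "chain_point c x \<in> segment c" using z zx by simp
  then have "chain_point c a \<in> segment c" "chain_point c b \<in> segment c"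
    using gap_in_segment[OF c ab x] ab by auto
  moreover have "C = chain_point c ` {a<..<b}" using word_class_eq_gap[OF c ab x] z zx by simp
  ultimately show "\<exists>a b. fraction_gap (chain_order c) a b \<and>
    chain_point c a \<in> segment c \<and> chain_point c b \<in> segment c \<and> C = chain_point c ` {a<..<b}"
    using ab by blast
next
  assume "\<exists>a b. fraction_gap (chain_order c) a b \<and>
    chain_point c a \<in> segment c \<and> chain_point c b \<in> segment c \<and> C = chain_point c ` {a<..<b}"
  then obtain a b where ab: "fraction_gap (chain_order c) a b"
    "chain_point c a \<in> segment c" "chain_point c b \<in> segment c" "C = chain_point c ` {a<..<b}" by blast
  then have "a < b" by (simp add: fraction_gap_def)
  then obtain x where x: "a < x" "x < b" using dense by blast
  then have xs: "chain_point c x \<in> segment c" using chain_point_segment_between ab by (meson less_imp_le)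
  then have "C = word_class c (chain_point c x)" using word_class_eq_gap[OF c ab(1) x] ab by simp
  moreover have "\<not> farey_point c (chain_point c x)"
    using x ab(1) by (auto simp: farey_point_iff[OF c] fraction_gap_def)
  ultimately show "C \<in> critical_curves c" using xs unfolding critical_curves_def by blast
qed

lemma curve_farey_points_eq:
  assumes c: "fst c \<noteq> 0" and g: "fraction_gap (chain_order c) a b"
    and s: "chain_point c a \<in> segment c" "chain_point c b \<in> segment c"
  shows "curve_farey_points c (chain_point c ` {a<..<b}) = {chain_point c a, chain_point c b}"
proof -
  have ab: "a < b" "a \<in> fractions_upto (chain_order c)" "b \<in> fractions_upto (chain_order c)"
    using g by (auto simp: fraction_gap_def)
  have none: "t \<notin> fractions_upto (chain_order c)" if "a < t" "t < b" for t
    using g that by (auto simp: fraction_gap_def)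
  have "farey_point c (chain_point c y) \<longleftrightarrow> y = a \<or> y = b" if "a \<le> y" "y \<le> b" for y
    using that ab none[of y] s chain_point_segment_between[OF s that]
    by (cases "a < y \<and> y < b") (auto simp: farey_point_iff[OF c])
  then show ?thesis using ab(1) by (auto simp: curve_farey_points_def closure_chain_point_image)
qed

text \<open>A horizontal chain has ordinate 0 or 1, so all its words are empty, and it has no
  end-points in the sense of \<open>end_point\<close>.\<close>

lemma word_class_horizontal: "z \<in> segment (0, j) \<Longrightarrow> j \<in> {0, - 1} \<Longrightarrow> word_class (0, j) z = segment (0, j)"
  by (auto simp: word_class_def end_point_def critical_word_def segment_def)

lemma critical_curves_horizontal:
  assumes "j \<in> {0, - 1}"
  shows "critical_curves (0, j) = {segment (0, j)}"
proof -
  have "\<not> farey_point (0, j) z" if "z \<in> segment (0, j)" for z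
  proof -
    have "(0, - of_int j) \<in> segment (0, j)" "(1, - of_int j) \<in> segment (0, j)"
      using assms by (auto simp: segment_def)
    then show ?thesis using word_class_horizontal[OF that assms]
      by (metis farey_point_def prod.inject singletonD zero_neq_one)
  qed
  moreover have "(0, - of_int j) \<in> segment (0, j)" using assms by (auto simp: segment_def)
  ultimately show ?thesis using word_class_horizontal[OF _ assms] unfolding critical_curves_def by blast
qed

section \<open>Chains through a rational critical point\<close>

lemma lowest_terms_divide:
  assumes "coprime p q" "q > 0"
  shows "num (of_int p / of_int q) = p" "den (of_int p / of_int q) = q"
proof -
  have "of_int p / of_int q = real_of_rat (Fract p q)"
    by (simp add: Fract_of_int_quotient of_rat_divide)
  moreover have "inj real_of_rat" by (simp add: inj_def)
  ultimately have "inv real_of_rat (of_int p / of_int q) = Fract p q" by (simp add: inv_f_f)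
  then have "lowest_terms (of_int p / of_int q) = (p, q)"
    using assms by (simp add: lowest_terms_def quotient_of_Fract normalize_stable)
  then show "num (of_int p / of_int q) = p" "den (of_int p / of_int q) = q"
    by (simp_all add: num_def den_def)
qed

lemma ex_chain_sign: "(\<exists>s. P s) \<longleftrightarrow> P Positive \<or> P Negative"
  by (metis chain_sign.exhaust)

text \<open>Encoding a quadrant by the signs of its two directions reduces four cases to one
  computation: the curves of its pencil lie on chains with
  \<open>sgn (fst c) = vdir Q * hdir Q\<close>.\<close>

definition vdir :: "quadrant_name \<Rightarrow> int" where
  "vdir Q = (if Q = Q1 \<or> Q = Q2 then 1 else - 1)"

definition hdir :: "quadrant_name \<Rightarrow> int" where
  "hdir Q = (if Q = Q1 \<or> Q = Q4 then 1 else - 1)"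

lemma quadrant_eq:
  "quadrant Q z = {w. of_int (hdir Q) * (fst w - fst z) \<ge> 0 \<and> of_int (vdir Q) * (snd w - snd z) \<ge> 0}"
  by (cases Q) (auto simp: quadrant_def hdir_def vdir_def)

locale rational_critical =
  fixes p q k :: int
  assumes q_pos: "q > 0" and coprime_pq: "coprime p q"
    and p_bounds: "0 \<le> p" "p \<le> q" and k_bounds: "0 \<le> k" "k \<le> q"
begin

abbreviation abscissa :: real where "abscissa \<equiv> of_int p / of_int q"
abbreviation centre :: point where "centre \<equiv> (abscissa, of_int k / of_int q)"

lemma p_interior: "1 < q \<Longrightarrow> 0 < p \<and> p < q"
  using coprime_pq p_bounds by (cases "p = 0"; cases "p = q") auto

lemma on_chain_iff: "centre \<in> segment c \<longleftrightarrow> fst c * p - snd c * q = k"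
proof -
  have "centre \<in> segment c \<longleftrightarrow> of_int k / of_int q = of_int (fst c) * (of_int p / of_int q) - (of_int (snd c) :: real)"
    using q_pos p_bounds k_bounds by (auto simp: segment_def)
  also have "\<dots> \<longleftrightarrow> (of_int k :: real) = of_int (fst c * p - snd c * q)"
    using q_pos by (simp add: field_simps)
  also have "\<dots> \<longleftrightarrow> fst c * p - snd c * q = k" by (simp only: of_int_eq_iff) auto
  finally show ?thesis .
qed

lemma centre_eq_chain_point: "fst c * p - snd c * q = k \<Longrightarrow> centre = chain_point c abscissa"
  using on_chain_iff[of c] segment_eqD[of centre c] by simp

section \<open>The fraction p / q and its Farey neighbours\<close>

lemma dvd_mult_p: "q dvd m * p \<longleftrightarrow> q dvd m"
  using coprime_pq by (simp add: coprime_commute coprime_dvd_mult_left_iff)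

lemma abscissa_in_fractions_iff: "abscissa \<in> fractions_upto I \<longleftrightarrow> q \<le> int I"
proof
  assume "abscissa \<in> fractions_upto I"
  then obtain m where m: "m \<in> {1..I}" "real m * abscissa \<in> \<int>" by (auto simp: fractions_upto_def)
  then obtain n where "real m * abscissa = of_int n" by (auto elim: Ints_cases)
  then have "(of_int (int m * p) :: real) = of_int (n * q)" using q_pos by (simp add: field_simps)
  then have "int m * p = n * q" by (simp only: of_int_eq_iff)
  then have "q dvd int m" using dvd_mult_p[of "int m"] by (metis dvd_triv_right)
  then have "q \<le> int m" using m(1) by (intro zdvd_imp_le) auto
  then show "q \<le> int I" using m(1) by auto
next
  assume "q \<le> int I"
  then show "abscissa \<in> fractions_upto I"
    using q_pos by (intro fractions_uptoI[of q]) auto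
qed

text \<open>The fraction \<open>u / v\<close> is the neighbour of \<open>p / q\<close> in direction \<open>e\<close> in the Farey sequence of order
  \<open>I\<close>; the window of length \<open>q\<close> for \<open>v\<close> makes it unique.\<close>

definition partner :: "int \<Rightarrow> int \<Rightarrow> int \<Rightarrow> int \<Rightarrow> bool" where
  "partner I e u v \<longleftrightarrow> u * q - p * v = e \<and> I - q < v \<and> v \<le> I"

lemma partner_exists: "\<exists>u v. partner I e u v"
proof -
  obtain a b where ab: "a * p + b * q = 1"
    using bezout_int[of p q] coprime_pq by (metis coprime_imp_gcd_eq_1)
  \<comment> \<open>With \<open>a\<close> inverse to \<open>p\<close> modulo \<open>q\<close>, the
    equation \<open>u * q - p * v = e\<close> asks for \<open>v\<close> congruent to
    \<open>- e * a\<close>; this is the largest such integer not exceeding \<open>I\<close>.\<close>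
  define v where "v = I - (I + e * a) mod q"
  have "0 \<le> (I + e * a) mod q" "(I + e * a) mod q < q" using q_pos by auto
  moreover have v: "v = - e * a + q * ((I + e * a) div q)"
    unfolding v_def minus_div_mult_eq_mod[symmetric] by (simp add: algebra_simps)
  have "(e * b + p * ((I + e * a) div q)) * q - p * v = e * (a * p + b * q)"
    unfolding v by (simp add: algebra_simps)
  ultimately show ?thesis unfolding partner_def v_def[symmetric] using ab
    by (intro exI[of _ "e * b + p * ((I + e * a) div q)"] exI[of _ v]) (auto simp: v_def)
qed

lemma partner_diff:
  assumes "partner I e u v" "v > 0"
  shows "of_int u / of_int v - abscissa = of_int e / (of_int v * of_int q)"
proof -
  have "real_of_int e = of_int u * of_int q - of_int p * of_int v"
    using assms(1) by (auto simp: partner_def)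
  then show ?thesis using assms(2) q_pos by (simp add: field_simps)
qed

text \<open>The mediant bound: for \<open>n / M\<close> strictly between \<open>p / q\<close> and
  \<open>u / v\<close> the determinants with both ends are, up to the sign \<open>e\<close>,
  positive integers, and \<open>M\<close> is their combination with coefficients \<open>q\<close>
  and \<open>v\<close>. It is applied both to the order of a pencil chain and to the smaller order
  of the dominant chain of a neighbour.\<close>

lemma order_between_partners:
  assumes uv: "u * q - p * v = e" "e \<in> {1, - 1}" "v > 0" and t: "t \<in> fractions_upto I"
    and btw: "min abscissa (of_int u / of_int v) < t" "t < max abscissa (of_int u / of_int v)"
  shows "q + v \<le> int I"
proof -
  obtain m where m: "m \<in> {1..I}" "real m * t \<in> \<int>" using t by (auto simp: fractions_upto_def)
  define M where "M = int m"
  have m0: "M > 0" "M \<le> int I" using m(1) by (auto simp: M_def)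
  obtain n where "of_int M * t = of_int n" using m(2) by (auto simp: M_def elim: Ints_cases)
  then have tn: "t = of_int n / of_int M" using m0 by (simp add: field_simps)
  have lt: "of_int a / of_int b < (of_int c / of_int d :: real) \<longleftrightarrow> a * d < c * b" if "b > 0" "d > 0" for a b c d :: int
  proof -
    have "of_int a / of_int b < (of_int c / of_int d :: real) \<longleftrightarrow> (of_int (a * d) :: real) < of_int (c * b)"
      using that by (simp add: field_simps)
    then show ?thesis by (simp only: of_int_less_iff)
  qed
  have *: "1 \<le> e * (n * q - p * M) \<and> 1 \<le> e * (u * M - n * v)"
  proof (cases "e = 1")
    case True
    have "abscissa < of_int u / of_int v" using uv True lt q_pos by simp
    then have "abscissa < t" "t < of_int u / of_int v" using btw by auto
    then show ?thesis using True lt q_pos uv(3) m0 unfolding tn by (simp add: mult.commute)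
  next
    case False
    then have e: "e = - 1" using uv(2) by simp
    have "of_int u / of_int v < abscissa" using uv e lt q_pos by simp
    then have "t < abscissa" "of_int u / of_int v < t" using btw by auto
    then show ?thesis using e lt q_pos uv(3) m0 unfolding tn by (simp add: mult.commute)
  qed
  have "M = e * e * M" using uv(2) by auto
  also have "\<dots> = q * (e * (u * M - n * v)) + v * (e * (n * q - p * M))"
    unfolding uv(1)[symmetric] by (simp add: algebra_simps)
  finally have "M = q * (e * (u * M - n * v)) + v * (e * (n * q - p * M))" .
  moreover have "q * 1 \<le> q * (e * (u * M - n * v))" "v * 1 \<le> v * (e * (n * q - p * M))"
    using * q_pos uv(3) by (intro mult_left_mono; simp)+
  ultimately show ?thesis using m0 by linarith
qed

text \<open>The bounds on \<open>j\<close> say that the line crosses from ordinate 0 to ordinate 1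
  within the square. They follow once the centre has room for a unit step of the numerators in the
  directions \<open>d\<close> (vertical) and \<open>sgn i * d\<close> (horizontal) along the line:
  each bound becomes a strict inequality between \<open>j * q\<close> and a multiple of
  \<open>q\<close>.\<close>

lemma is_chain_throughI:
  assumes thr: "i * p - j * q = k" and i: "i \<noteq> 0" and d: "d \<in> {1, - 1}" "0 \<le> k + d" "k + d \<le> q"
    and e: "0 \<le> p + sgn i * d" "p + sgn i * d \<le> q"
  shows "is_chain (i, j)"
proof -
  have cancel: "a < b" if "a * q < b * q" for a b using that q_pos by simp
  consider (pp) "i \<ge> 1" "d = 1" | (pm) "i \<ge> 1" "d = - 1" | (mp) "i \<le> - 1" "d = 1" | (mm) "i \<le> - 1" "d = - 1"
    using i d by force
  then show ?thesis
  proof cases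
    case pp
    then have *: "k \<le> q - 1" "p \<le> q - 1" using d e by auto
    have "i * p \<le> i * (q - 1)" "0 \<le> i * p" using pp * p_bounds by (auto intro: mult_left_mono)
    moreover have "i * (q - 1) = i * q - i" by (simp add: algebra_simps)
    ultimately have "- q < j * q" "j * q < i * q" using thr * k_bounds pp by linarith+
    then show ?thesis using pp cancel[of "- 1" j] cancel[of j i] by (auto simp: is_chain_def)
  next
    case pm
    then have *: "k \<ge> 1" "p \<ge> 1" using d e by auto
    have "i * p \<le> i * q" using pm p_bounds by (intro mult_left_mono) auto
    moreover have "1 * 1 \<le> i * p" using pm * by (intro mult_mono) auto
    ultimately have "- q < j * q" "j * q < i * q" using thr * k_bounds pm by linarith+
    then show ?thesis using pm cancel[of "- 1" j] cancel[of j i] by (auto simp: is_chain_def)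
  next
    case mp
    then have *: "k \<le> q - 1" "p \<ge> 1" using d e by auto
    have "(- i) * p \<le> (- i) * q" using mp p_bounds by (intro mult_left_mono) auto
    moreover have "1 * 1 \<le> (- i) * p" using mp * by (intro mult_mono) auto
    ultimately have "i * q - q < j * q" "j * q < 0" using thr * k_bounds by linarith+
    moreover have "(i - 1) * q = i * q - q" by (simp add: algebra_simps)
    ultimately show ?thesis using mp cancel[of "i - 1" j] cancel[of j 0] by (auto simp: is_chain_def)
  next
    case mm
    then have *: "k \<ge> 1" "p \<le> q - 1" using d e by auto
    have "(- i) * p \<le> (- i) * (q - 1)" using mm * by (intro mult_left_mono) auto
    moreover have "0 \<le> (- i) * p" using mm p_bounds by (intro mult_nonneg_nonneg) auto
    moreover have "(- i) * (q - 1) = i - i * q" by (simp add: algebra_simps)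
    ultimately have "i * q - q < j * q" "j * q < 0" using thr * k_bounds mm by linarith+
    moreover have "(i - 1) * q = i * q - q" by (simp add: algebra_simps)
    ultimately show ?thesis using mm cancel[of "i - 1" j] cancel[of j 0] by (auto simp: is_chain_def)
  qed
qed

section \<open>Dominant and non-dominant chains in terms of their order\<close>

lemma through_congruent:
  assumes "i * p - j * q = k" "i' * p - j' * q = k"
  shows "q dvd i - i'"
proof -
  have "(i - i') * p = (j - j') * q" using assms by (simp add: algebra_simps)
  then show ?thesis using dvd_mult_p by (metis dvd_triv_right)
qed

lemma through_unique:
  assumes "i * p - j * q = k" "i * p - j' * q = k" shows "j = j'"
  using assms q_pos by auto

lemma is_chain_interior:
  assumes "0 < k" "k < q" "i * p - j * q = k" "i \<noteq> 0"
  shows "is_chain (i, j)"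
  using assms p_interior by (intro is_chain_throughI[OF assms(3,4), of 1]) (auto simp: sgn_if)

lemma centre_snd_iff: "snd centre = 0 \<longleftrightarrow> k = 0" "snd centre = 1 \<longleftrightarrow> k = q"
  using q_pos by auto

text \<open>The values of \<open>i\<close> on lines through the centre form one residue class modulo
  \<open>q\<close>. An order of at least \<open>q\<close> can be lowered by \<open>q\<close> without
  changing the sign, and two members of one sign with order below \<open>q\<close> coincide;
  minimality thus means order below \<open>q\<close>.\<close>

lemma dominant_interior_iff:
  assumes k: "0 < k" "k < q"
  shows "dominant_chain s centre c \<longleftrightarrow>
    fst c * p - snd c * q = k \<and> fst c \<noteq> 0 \<and> chain_has_sign s c \<and> \<bar>fst c\<bar> < q"
proof
  assume D: "dominant_chain s centre c"
  then have c: "fst c * p - snd c * q = k" "fst c \<noteq> 0" "chain_has_sign s c"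
    using k centre_snd_iff on_chain_iff by (auto simp: dominant_chain_def)
  have "\<bar>fst c\<bar> < q"
  proof (rule ccontr)
    assume n: "\<not> \<bar>fst c\<bar> < q"
    define c' where "c' = (fst c - sgn (fst c) * q, snd c - sgn (fst c) * p)"
    have thr: "fst c' * p - snd c' * q = k" using c(1) by (simp add: c'_def algebra_simps)
    \<comment> \<open>This prevents \<open>fst c\<close> from being \<open>q\<close> or
      \<open>- q\<close>, so the shifted chain does not become horizontal.\<close>
    have "\<not> q dvd k" using k zdvd_not_zless by blast
    then have "\<not> q dvd fst c" using c(1) by (metis dvd_diff dvd_mult2 dvd_triv_right)
    then have "fst c \<noteq> q" "fst c \<noteq> - q" by auto
    then have "fst c' \<noteq> 0" "chain_has_sign s c'" "\<bar>fst c'\<bar> < \<bar>fst c\<bar>"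
      using c n q_pos by (auto simp: c'_def chain_has_sign_def sgn_if split: chain_sign.splits)
    moreover have "is_chain c'" using is_chain_interior[OF k thr] \<open>fst c' \<noteq> 0\<close> by simp
    moreover have "centre \<in> segment c'" using thr on_chain_iff by blast
    moreover have "\<forall>c'. is_chain c' \<and> centre \<in> segment c' \<and> fst c' \<noteq> 0 \<and> chain_has_sign s c' \<longrightarrow> \<bar>fst c\<bar> \<le> \<bar>fst c'\<bar>"
      using D k q_pos by (auto simp: dominant_chain_def)
    ultimately show False by (meson not_le)
  qed
  with c show "fst c * p - snd c * q = k \<and> fst c \<noteq> 0 \<and> chain_has_sign s c \<and> \<bar>fst c\<bar> < q" by simp
next
  assume c: "fst c * p - snd c * q = k \<and> fst c \<noteq> 0 \<and> chain_has_sign s c \<and> \<bar>fst c\<bar> < q"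
  have "\<bar>fst c\<bar> \<le> \<bar>fst c'\<bar>" if c': "centre \<in> segment c'" "fst c' \<noteq> 0" "chain_has_sign s c'" for c'
  proof (rule ccontr)
    assume n: "\<not> \<bar>fst c\<bar> \<le> \<bar>fst c'\<bar>"
    have "q dvd fst c - fst c'" using c c'(1) through_congruent on_chain_iff by blast
    moreover have "\<bar>fst c - fst c'\<bar> < q" "fst c - fst c' \<noteq> 0"
      using c c' n by (auto simp: chain_has_sign_def split: chain_sign.splits)
    ultimately show False by (metis zdvd_not_zless zero_less_abs_iff dvd_abs_iff)
  qed
  then show "dominant_chain s centre c"
    using c k centre_snd_iff on_chain_iff[of c] is_chain_interior[OF k, of "fst c" "snd c"]
    by (auto simp: dominant_chain_def)
qed

lemma dominant_bottom_iff:
  assumes "k = 0"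
  shows "dominant_chain s centre c \<longleftrightarrow> is_chain c \<and> c = (case s of Positive \<Rightarrow> (0, 0) | Negative \<Rightarrow> (- q, - p))"
  using assms lowest_terms_divide[OF coprime_pq q_pos] by (cases s) (simp_all add: dominant_chain_def)

lemma dominant_top_iff:
  assumes "k = q"
  shows "dominant_chain s centre c \<longleftrightarrow> is_chain c \<and> c = (case s of Positive \<Rightarrow> (q, p - 1) | Negative \<Rightarrow> (0, - 1))"
  using assms lowest_terms_divide[OF coprime_pq q_pos] q_pos by (cases s) (simp_all add: dominant_chain_def)

lemma horizontal_through:
  assumes "is_chain c" "fst c * p - snd c * q = k" "fst c = 0"
  shows "k = 0 \<and> c = (0, 0) \<or> k = q \<and> c = (0, - 1)"
proof -
  obtain j where c: "c = (0, j)" using assms(3) by (cases c) auto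
  then have "j = 0 \<or> j = - 1" using assms(1) by (auto simp: is_chain_def)
  then show ?thesis using assms c by auto
qed

text \<open>On an edge \<open>i\<close> is a multiple of \<open>q\<close>, so a chain through the
  centre is horizontal or has order at least \<open>q\<close>. The two exceptions are the chains of
  order exactly \<open>q\<close> that are dominant at \<open>k = 0\<close> and at
  \<open>k = q\<close>.\<close>

lemma nondominant_iff:
  "c \<in> nondominant_chains centre \<longleftrightarrow> is_chain c \<and> fst c * p - snd c * q = k \<and> q \<le> \<bar>fst c\<bar> \<and>
    \<not> (k = 0 \<and> fst c = - q) \<and> \<not> (k = q \<and> fst c = q)"
  (is "?L \<longleftrightarrow> ?R")
proof (cases "is_chain c \<and> fst c * p - snd c * q = k")
  case True
  then have ch: "is_chain c" and thr: "fst c * p - snd c * q = k" by auto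
  have L: "?L \<longleftrightarrow> \<not> (\<exists>s. dominant_chain s centre c)"
    using ch thr on_chain_iff by (auto simp: nondominant_chains_def)
  have sgns: "\<exists>s. chain_has_sign s c"
    by (cases "fst c \<ge> 0") (auto simp: chain_has_sign_def intro: exI[of _ Positive] exI[of _ Negative])
  consider (int) "0 < k" "k < q" | (bot) "k = 0" | (top) "k = q" using k_bounds by linarith
  then show ?thesis
  proof cases
    case int
    have "fst c \<noteq> 0" using horizontal_through[OF ch thr] int by auto
    then show ?thesis unfolding L dominant_interior_iff[OF int] using ch thr sgns int by auto
  next
    case bot
    have dv: "q dvd fst c" using thr bot dvd_mult_p[of "fst c"] by (metis dvd_triv_right eq_iff_diff_eq_0)
    have "fst c \<noteq> 0 \<Longrightarrow> q \<le> \<bar>fst c\<bar>" using dvd_imp_le_int[OF _ dv] q_pos by auto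
    moreover have "fst c = 0 \<longleftrightarrow> c = (0, 0)" using horizontal_through[OF ch thr] bot q_pos by auto
    moreover have "fst c = - q \<longleftrightarrow> c = (- q, - p)"
      using thr bot through_unique[of "- q" "snd c" "- p"] by (metis diff_0_right diff_self minus_mult_commute mult.commute prod.collapse fst_conv)
    moreover have "(\<exists>s. dominant_chain s centre c) \<longleftrightarrow> c = (0, 0) \<or> c = (- q, - p)"
      unfolding dominant_bottom_iff[OF bot] ex_chain_sign using ch by auto
    ultimately show ?thesis unfolding L using ch thr bot q_pos by auto
  next
    case top
    have "(fst c) * p = (snd c + 1) * q" using thr top by (simp add: algebra_simps)
    then have dv: "q dvd fst c" using dvd_mult_p[of "fst c"] by (metis dvd_triv_right)
    have "fst c \<noteq> 0 \<Longrightarrow> q \<le> \<bar>fst c\<bar>" using dvd_imp_le_int[OF _ dv] q_pos by auto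
    moreover have "fst c = 0 \<longleftrightarrow> c = (0, - 1)" using horizontal_through[OF ch thr] top q_pos by auto
    moreover have "fst c = q \<longleftrightarrow> c = (q, p - 1)"
      using thr top through_unique[of q "snd c" "p - 1"] by (cases c) (auto simp: algebra_simps)
    moreover have "(\<exists>s. dominant_chain s centre c) \<longleftrightarrow> c = (q, p - 1) \<or> c = (0, - 1)"
      unfolding dominant_top_iff[OF top] ex_chain_sign using ch by auto
    ultimately show ?thesis unfolding L using ch thr top q_pos by auto
  qed
qed (auto simp: nondominant_chains_def on_chain_iff)

lemma nondominant_unbounded:
  assumes d: "d \<in> {1, - 1}" "0 \<le> k + d" "k + d \<le> q" and e: "e \<in> {1, - 1}" "0 \<le> p + e" "p + e \<le> q"
  shows "\<exists>c \<in> nondominant_chains centre. sgn (fst c) = d * e \<and> B \<le> \<bar>fst c\<bar>"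
proof -
  obtain a b where ab: "a * p + b * q = 1"
    using bezout_int[of p q] coprime_pq by (metis coprime_imp_gcd_eq_1)
  \<comment> \<open>The shift by \<open>t * q\<close> outweighs the Bezout term \<open>k * a\<close>
    and so fixes the sign; the summand \<open>2 * q\<close> keeps the order above \<open>q\<close>,
    away from the exceptional chains of order \<open>q\<close>.\<close>
  define t where "t = \<bar>k * a\<bar> + \<bar>B\<bar> + 2 * q"
  define i where "i = k * a + d * e * t * q"
  define j where "j = - (k * b) + d * e * t * p"
  have "i * p - j * q = k * (a * p + b * q)" by (simp add: i_def j_def algebra_simps)
  then have thr: "i * p - j * q = k" using ab by simp
  have t: "t > \<bar>k * a\<bar>" using q_pos by (simp add: t_def)
  then have "t * 1 \<le> t * q" using q_pos by (intro mult_left_mono) auto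
  have big: "t * q - \<bar>k * a\<bar> \<ge> \<bar>B\<bar> + 2 * q" using \<open>t * 1 \<le> t * q\<close> by (simp add: t_def)
  have de: "d * e = 1 \<or> d * e = - 1" using d e by auto
  then have sg: "sgn i = d * e" "\<bar>i\<bar> \<ge> \<bar>B\<bar> + 2 * q"
    using big q_pos t unfolding i_def by (auto simp: sgn_if)
  have "sgn i * d = e" unfolding sg using d(1) by auto
  then have "is_chain (i, j)" using sg q_pos e by (intro is_chain_throughI[OF thr _ d]) auto
  then have "(i, j) \<in> nondominant_chains centre"
    unfolding nondominant_iff using thr sg(2) q_pos by auto
  moreover have "B \<le> \<bar>i\<bar>" using sg(2) q_pos by linarith
  ultimately show ?thesis using sg by (intro bexI[of _ "(i, j)"]) auto
qed

text \<open>For \<open>q > 1\<close> the abscissa is strictly inside the square. At a corner, where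
  \<open>q = 1\<close>, the bounds on \<open>j\<close> admit only chains of the sign that points
  into the square.\<close>

lemma nondominant_direction:
  assumes c: "c \<in> nondominant_chains centre" and d: "d \<in> {1, - 1}" "0 \<le> k + d" "k + d \<le> q"
  shows "0 \<le> p + sgn (fst c) * d" "p + sgn (fst c) * d \<le> q"
proof -
  have ch: "is_chain c" "fst c * p - snd c * q = k" "fst c \<noteq> 0"
    using c q_pos unfolding nondominant_iff by auto
  have "0 \<le> p + sgn (fst c) * d \<and> p + sgn (fst c) * d \<le> q"
  proof (cases "q = 1")
    case False
    then show ?thesis using p_interior q_pos d(1) ch(3) by (auto simp: sgn_if)
  next
    case True
    have "p = 0 \<or> p = 1" using p_bounds True by auto
    then show ?thesis using ch d True k_bounds by (auto simp: is_chain_def sgn_if split: prod.splits)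
  qed
  then show "0 \<le> p + sgn (fst c) * d" "p + sgn (fst c) * d \<le> q" by auto
qed

end

lemma vdir_cases: "vdir Q \<in> {1, - 1}" and hdir_cases: "hdir Q \<in> {1, - 1}"
  by (auto simp: vdir_def hdir_def)

lemma quadrant_eqI: "vdir Q = vdir Q' \<Longrightarrow> hdir Q = hdir Q' \<Longrightarrow> Q = Q'"
  by (cases Q; cases Q') (auto simp: vdir_def hdir_def)

section \<open>Curves leaving the centre on chains of order at least q\<close>

context rational_critical
begin

definition side :: "real \<Rightarrow> real set" where
  "side t = {min abscissa t<..<max abscissa t}"

lemma partner_unique:
  assumes "partner I e u v" "partner I e u' v'"
  shows "u = u'" "v = v'"
proof -
  have "(v - v') * p = (u - u') * q" using assms by (simp add: partner_def algebra_simps)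
  then have "q dvd v - v'" using dvd_mult_p by (metis dvd_triv_right)
  moreover have "\<bar>v - v'\<bar> < q" using assms by (auto simp: partner_def)
  ultimately show "v = v'" by (metis dvd_abs_iff zdvd_not_zless zero_less_abs_iff eq_iff_diff_eq_0)
  with assms show "u = u'" using q_pos by (auto simp: partner_def)
qed

context
  fixes I :: nat and e u v :: int
  assumes partner: "partner (int I) e u v" and e: "e \<in> {1, - 1}" and I: "q \<le> int I"
begin

lemma partner_pos: "v > 0"
  using partner I by (auto simp: partner_def)

lemma partner_side: "0 < of_int e * (of_int u / of_int v - abscissa)"
  using partner_diff[OF partner partner_pos] e partner_pos q_pos by auto

text \<open>The lower end of the window for \<open>v\<close> matters here: a fraction strictly
  between would require \<open>q + v \<le> I\<close>, against \<open>I - q < v\<close>.\<close>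

lemma partner_gap: "fraction_gap I (min abscissa (of_int u / of_int v)) (max abscissa (of_int u / of_int v))"
proof -
  have "of_int u / of_int v \<in> fractions_upto I"
    using partner partner_pos by (intro fractions_uptoI[of v]) (auto simp: partner_def)
  moreover have "abscissa \<in> fractions_upto I" using I abscissa_in_fractions_iff by blast
  moreover have "t \<notin> fractions_upto I" if "min abscissa (of_int u / of_int v) < t" "t < max abscissa (of_int u / of_int v)" for t
    using order_between_partners[of u v e t I] that partner partner_pos e by (auto simp: partner_def)
  moreover have "of_int u / of_int v \<noteq> abscissa" using partner_side by auto
  ultimately show ?thesis unfolding fraction_gap_def min_def max_def by auto
qed

lemma side_direction: "t \<in> side (of_int u / of_int v) \<Longrightarrow> 0 < of_int e * (t - abscissa)"
  using partner_side e by (auto simp: side_def min_def max_def split: if_splits)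

lemma side_nonempty: "side (of_int u / of_int v) \<noteq> {}"
  using partner_side by (auto simp: side_def min_def max_def)

end

context
  fixes c :: chain
  assumes thr: "fst c * p - snd c * q = k" and order: "q \<le> \<bar>fst c\<bar>"
begin

lemma order_facts: "fst c \<noteq> 0" "int (chain_order c) = \<bar>fst c\<bar>" "q \<le> int (chain_order c)"
  using order q_pos by auto

lemma height_diff: "snd (chain_point c t) - of_int k / of_int q = of_int (fst c) * (t - abscissa)"
proof -
  have "of_int k / of_int q = snd (chain_point c abscissa)"
    using centre_eq_chain_point[OF thr] by (metis snd_conv)
  then show ?thesis by (simp add: algebra_simps)
qed

text \<open>A short step from the centre stays in the square, since the numerators \<open>p\<close>
  and \<open>k\<close> have room for a unit step. It lands inside the gap, and
  \<open>gap_in_segment\<close> then carries the whole gap, with its far end, into the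
  chain.\<close>

lemma partner_point_in_segment:
  assumes P: "partner \<bar>fst c\<bar> e u v" and e: "e \<in> {1, - 1}" "0 \<le> p + e" "p + e \<le> q"
    and d: "0 \<le> k + sgn (fst c) * e" "k + sgn (fst c) * e \<le> q"
  shows "chain_point c (of_int u / of_int v) \<in> segment c"
proof -
  have P': "partner (int (chain_order c)) e u v" using P by simp
  note o = order_facts
  have v0: "v > 0" using partner_pos[OF P' e(1) o(3)] .
  \<comment> \<open>Small enough on both counts: below \<open>1 / (v * q)\<close>, the length of the
    gap, because \<open>v\<close> is at most the order; and multiplied by the order at most
    \<open>1 / q\<close>, which bounds the change of height.\<close>
  define \<epsilon> where "\<epsilon> = 1 / (of_int q * (of_int \<bar>fst c\<bar> + 1) :: real)"
  define x where "x = abscissa + of_int e * \<epsilon>"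
  have "v \<le> \<bar>fst c\<bar>" using P by (simp add: partner_def)
  then have "of_int v \<le> (of_int \<bar>fst c\<bar> :: real)" by (simp only: of_int_le_iff)
  then have "of_int v * of_int q < (of_int q * (of_int \<bar>fst c\<bar> + 1) :: real)"
    using q_pos by (simp add: mult.commute)
  then have lt: "\<epsilon> < 1 / (of_int v * of_int q)"
    unfolding \<epsilon>_def using q_pos v0 by (intro divide_strict_left_mono) (auto intro!: mult_pos_pos add_nonneg_pos)
  have \<epsilon>0: "\<epsilon> > 0" using q_pos by (auto simp: \<epsilon>_def intro!: divide_pos_pos mult_pos_pos add_nonneg_pos)
  have \<epsilon>q: "of_int \<bar>fst c\<bar> * \<epsilon> \<le> 1 / of_int q" "\<epsilon> \<le> 1 / of_int q"
  proof -
    have "(of_int \<bar>fst c\<bar> + 1 :: real) \<noteq> 0" by (smt (verit) abs_ge_zero of_int_0_le_iff)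
    moreover have "A * (1 / (Q * (A + 1))) + 1 / (Q * (A + 1)) = 1 / Q" if "A + 1 \<noteq> 0" for A Q :: real
    proof -
      have "A * (1 / (Q * (A + 1))) + 1 / (Q * (A + 1)) = (A + 1) * (1 / (Q * (A + 1)))" by (simp only: distrib_right mult_1)
      then show ?thesis using that by simp
    qed
    ultimately have "of_int \<bar>fst c\<bar> * \<epsilon> + \<epsilon> = 1 / of_int q" unfolding \<epsilon>_def by blast
    moreover have "0 \<le> of_int \<bar>fst c\<bar> * \<epsilon>" using \<epsilon>0 by simp
    ultimately show "of_int \<bar>fst c\<bar> * \<epsilon> \<le> 1 / of_int q" "\<epsilon> \<le> 1 / of_int q" using \<epsilon>0 by linarith+
  qed
  have bound: "0 \<le> of_int n / of_int q + of_int \<sigma> * \<delta> \<and> of_int n / of_int q + of_int \<sigma> * \<delta> \<le> 1"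
    if "\<sigma> \<in> {1, - 1}" "0 \<le> n" "n \<le> q" "0 \<le> n + \<sigma>" "n + \<sigma> \<le> q" "0 \<le> \<delta>" "\<delta> \<le> 1 / of_int q" for n \<sigma> :: int and \<delta> :: real
  proof -
    have "of_int (n + \<sigma>) \<le> (of_int q :: real)" "0 \<le> (of_int (n + \<sigma>) :: real)"
      "0 \<le> (of_int n :: real)" "of_int n \<le> (of_int q :: real)"
      using that by (simp_all only: of_int_le_iff of_int_0_le_iff)
    then have "of_int n / of_int q + of_int \<sigma> / of_int q \<le> (1 :: real)" "0 \<le> of_int n / of_int q + (of_int \<sigma> / of_int q :: real)"
      "0 \<le> of_int n / (of_int q :: real)" "of_int n / (of_int q :: real) \<le> 1"
      using q_pos by (simp_all add: add_divide_distrib[symmetric])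
    moreover have "of_int \<sigma> = (1 :: real) \<or> of_int \<sigma> = (- 1 :: real)" using that(1) by auto
    ultimately show ?thesis using that(6,7)
      by (elim disjE; simp only: mult_1_left mult_minus1 divide_minus_left; linarith)
  qed
  have "x \<in> {0..1}" unfolding x_def using bound[of e p \<epsilon>] e p_bounds \<epsilon>0 \<epsilon>q by auto
  moreover have "snd (chain_point c x) = of_int k / of_int q + of_int (sgn (fst c) * e) * (of_int \<bar>fst c\<bar> * \<epsilon>)"
  proof -
    have "real_of_int (fst c) = of_int (sgn (fst c)) * of_int \<bar>fst c\<bar>" by (metis of_int_mult sgn_mult_abs)
    then have "of_int (fst c) * (x - abscissa) = (of_int (sgn (fst c)) * of_int \<bar>fst c\<bar>) * (of_int e * \<epsilon>)"
      by (simp add: x_def)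
    also have "\<dots> = of_int (sgn (fst c) * e) * (of_int \<bar>fst c\<bar> * \<epsilon>)" by (simp only: of_int_mult mult_ac)
    finally show ?thesis using height_diff[of x] by linarith
  qed
  moreover have "sgn (fst c) * e \<in> {1, - 1}" using o(1) e(1) by (auto simp: sgn_if)
  ultimately have xs: "chain_point c x \<in> segment c"
    unfolding chain_point_in_segment_iff snd_chain_point[symmetric]
    using bound[of "sgn (fst c) * e" k "of_int \<bar>fst c\<bar> * \<epsilon>"] d k_bounds \<epsilon>0 \<epsilon>q(1) by auto
  have pd: "of_int u / of_int v = abscissa + of_int e * (1 / (of_int v * of_int q))"
    using partner_diff[OF P v0] by simp
  have "min abscissa (of_int u / of_int v) < x" "x < max abscissa (of_int u / of_int v)"
    using e(1) lt \<epsilon>0 unfolding pd x_def by auto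
  then show ?thesis
    by (intro gap_in_segment[OF o(1) partner_gap[OF P' e(1) o(3)] _ _ xs]) auto
qed

lemma side_curve_critical:
  assumes P: "partner \<bar>fst c\<bar> e u v" and e: "e \<in> {1, - 1}" "0 \<le> p + e" "p + e \<le> q"
    and d: "0 \<le> k + sgn (fst c) * e" "k + sgn (fst c) * e \<le> q"
  defines "C \<equiv> chain_point c ` side (of_int u / of_int v)"
  shows "C \<in> adjacent_curves centre c"
    and "curve_farey_points c C = {centre, chain_point c (of_int u / of_int v)}"
proof -
  have P': "partner (int (chain_order c)) e u v" using P by simp
  have g: "fraction_gap (chain_order c) (min abscissa (of_int u / of_int v)) (max abscissa (of_int u / of_int v))"
    using partner_gap[OF P' e(1) order_facts(3)] .
  have z: "centre = chain_point c abscissa" using centre_eq_chain_point thr .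
  then have "chain_point c abscissa \<in> segment c" using thr on_chain_iff by metis
  then have s: "chain_point c (min abscissa (of_int u / of_int v)) \<in> segment c"
    "chain_point c (max abscissa (of_int u / of_int v)) \<in> segment c"
    using partner_point_in_segment[OF P e d] by (auto simp: min_def max_def)
  have "min abscissa (of_int u / of_int v) < max abscissa (of_int u / of_int v)" using g by (simp add: fraction_gap_def)
  then have "centre \<in> closure C"
    unfolding C_def side_def z by (simp add: closure_chain_point_image)
  then show "C \<in> adjacent_curves centre c"
    using critical_curves_iff[OF order_facts(1)] g s unfolding adjacent_curves_def C_def side_def by blast
  have "curve_farey_points c C = {chain_point c (min abscissa (of_int u / of_int v)), chain_point c (max abscissa (of_int u / of_int v))}"
    unfolding C_def side_def by (rule curve_farey_points_eq[OF order_facts(1) g s])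
  then show "curve_farey_points c C = {centre, chain_point c (of_int u / of_int v)}"
    unfolding z by (auto simp: min_def max_def)
qed

text \<open>The abscissa of the centre is a fraction of the order of the chain, so it is an end of
  the gap, and uniqueness of overlapping gaps identifies the other end as \<open>u / v\<close>. That
  end lies in the square strictly above or below the centre, which yields the bounds on
  \<open>k + sgn (fst c) * e\<close>.\<close>

lemma adjacent_curve_cases:
  assumes "C \<in> adjacent_curves centre c"
  obtains e u v where "e \<in> {1, - 1}" "partner \<bar>fst c\<bar> e u v"
    "0 \<le> k + sgn (fst c) * e" "k + sgn (fst c) * e \<le> q" "C = chain_point c ` side (of_int u / of_int v)"
proof -
  note found = that and o = order_facts
  obtain a b where ab: "fraction_gap (chain_order c) a b" "chain_point c a \<in> segment c"
    "chain_point c b \<in> segment c" "C = chain_point c ` {a<..<b}" and cl: "centre \<in> closure C"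
    using assms critical_curves_iff[OF o(1)] by (auto simp: adjacent_curves_def)
  have lt: "a < b" using ab(1) by (simp add: fraction_gap_def)
  have z: "centre = chain_point c abscissa" using centre_eq_chain_point thr .
  have "abscissa \<in> {a..b}" using cl unfolding ab(4) closure_chain_point_image[OF lt] z by auto
  moreover have "abscissa \<in> fractions_upto (chain_order c)" using abscissa_in_fractions_iff o(3) by blast
  ultimately have x: "abscissa = a \<or> abscissa = b"
    using ab(1) by (cases "a < abscissa \<and> abscissa < b") (auto simp: fraction_gap_def)
  have main: thesis if e: "e \<in> {1, - 1}" and e1: "e = 1 \<Longrightarrow> abscissa = a" and e2: "e = - 1 \<Longrightarrow> abscissa = b" for e :: int
  proof -
    obtain u v where P: "partner \<bar>fst c\<bar> e u v" using partner_exists by blast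
    have P': "partner (int (chain_order c)) e u v" using P by simp
    have sd: "0 < of_int e * (of_int u / of_int v - abscissa)" using partner_side[OF P' e o(3)] .
    note g = partner_gap[OF P' e o(3)]
    have u: "a = min abscissa (of_int u / of_int v) \<and> b = max abscissa (of_int u / of_int v)"
    proof (cases "e = 1")
      case True
      then show ?thesis using sd e1 lt fraction_gap_unique[OF ab(1) g] by auto
    next
      case False
      then show ?thesis using e sd e2 lt fraction_gap_unique[OF ab(1) g] by auto
    qed
    then have ps: "chain_point c (of_int u / of_int v) \<in> segment c" using ab(2,3) by (auto simp: min_def max_def split: if_splits)
    have h: "snd (chain_point c (of_int u / of_int v)) - of_int k / of_int q = of_int (fst c * e) * (of_int e * (of_int u / of_int v - abscissa))"
      unfolding height_diff using e by auto
    have k1: "0 \<le> snd (chain_point c (of_int u / of_int v))" "snd (chain_point c (of_int u / of_int v)) \<le> 1"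
      using ps by (auto simp: chain_point_in_segment_iff)
    have "0 \<le> k + sgn (fst c) * e \<and> k + sgn (fst c) * e \<le> q"
    proof (cases "fst c * e > 0")
      case True
      then have "0 < of_int (fst c * e) * (of_int e * (of_int u / of_int v - abscissa))" 
        using mult_pos_pos[OF _ sd, of "of_int (fst c * e)"] by (simp only: of_int_0_less_iff)
      then have "of_int k / of_int q < (1 :: real)" using h k1 by linarith
      then have "k < q" using q_pos by simp
      moreover have "sgn (fst c) * e = 1" using True e by (auto simp: sgn_if)
      ultimately show ?thesis using k_bounds by simp
    next
      case False
      then have neg: "fst c * e < 0" using o(1) e by (auto simp: not_less le_less)
      then have "of_int (fst c * e) * (of_int e * (of_int u / of_int v - abscissa)) < 0" 
        using mult_neg_pos[OF _ sd, of "of_int (fst c * e)"] by (simp only: of_int_less_0_iff)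
      then have "0 < of_int k / (of_int q :: real)" using h k1 by linarith
      then have "0 < k" using q_pos by (simp add: zero_less_divide_iff)
      moreover have "sgn (fst c) * e = - 1" using neg e by (auto simp: sgn_if)
      ultimately show ?thesis using k_bounds by simp
    qed
    moreover have "C = chain_point c ` side (of_int u / of_int v)" using u ab(4) by (simp add: side_def)
    ultimately show thesis using found P e by blast
  qed
  show thesis using x main[of 1] main[of "- 1"] by auto
qed

text \<open>Both coordinate differences to the centre keep one non-zero sign along the curve, so a
  single point of it decides the quadrant.\<close>

lemma side_curve_subset_quadrant_iff:
  assumes P: "partner \<bar>fst c\<bar> e u v" and e: "e \<in> {1, - 1}"
  shows "chain_point c ` side (of_int u / of_int v) \<subseteq> quadrant Q centre \<longleftrightarrow> hdir Q = e \<and> vdir Q = sgn (fst c) * e"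
proof -
  have P': "partner (int (chain_order c)) e u v" using P by simp
  have sd: "0 < of_int e * (t - abscissa)" if "t \<in> side (of_int u / of_int v)" for t
    using side_direction[OF P' e order_facts(3) that] .
  have sh: "0 < of_int (sgn (fst c) * e) * (snd (chain_point c t) - of_int k / of_int q)" if "t \<in> side (of_int u / of_int v)" for t
  proof -
    have "of_int (sgn (fst c) * e) * (snd (chain_point c t) - of_int k / of_int q) = of_int \<bar>fst c\<bar> * (of_int e * (t - abscissa))"
      unfolding height_diff by (simp add: sgn_if)
    moreover have "0 < (of_int \<bar>fst c\<bar> :: real)" using order_facts(1) by simp
    ultimately show ?thesis using sd[OF that] by (metis mult_pos_pos)
  qed
  obtain t where t: "t \<in> side (of_int u / of_int v)" using side_nonempty[OF P' e order_facts(3)] by auto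
  have sg: "sgn (fst c) * e \<in> {1, - 1}" using order_facts(1) e by (auto simp: sgn_if)
  have dir: "\<delta> = \<eta>" if "0 \<le> of_int \<delta> * (y :: real)" "0 < of_int \<eta> * y" "\<delta> \<in> {1, - 1}" "\<eta> \<in> {1, - 1}" for \<delta> \<eta> :: int and y
    using that by auto
  show ?thesis
  proof
    assume "chain_point c ` side (of_int u / of_int v) \<subseteq> quadrant Q centre"
    then have "chain_point c t \<in> quadrant Q centre" using t by auto
    then have "0 \<le> of_int (hdir Q) * (t - abscissa)" "0 \<le> of_int (vdir Q) * (snd (chain_point c t) - of_int k / of_int q)"
      by (auto simp: quadrant_eq)
    then show "hdir Q = e \<and> vdir Q = sgn (fst c) * e"
      using dir[OF _ sd[OF t] hdir_cases e] dir[OF _ sh[OF t] vdir_cases sg] by blast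
  next
    assume "hdir Q = e \<and> vdir Q = sgn (fst c) * e"
    then show "chain_point c ` side (of_int u / of_int v) \<subseteq> quadrant Q centre"
      using sd sh by (force simp: quadrant_eq)
  qed
qed

end

end

section \<open>Pencils\<close>

lemma horizontal_chain_cases:
  assumes "is_chain c" "fst c = 0"
  obtains j where "c = (0, j)" "j \<in> {0, - 1}"
proof -
  have "snd c \<in> {0, - 1}" using assms by (cases c) (auto simp: is_chain_def)
  then show thesis using that[of "snd c"] assms(2) by (metis prod.collapse)
qed

lemma critical_curve_closure:
  assumes "is_chain c" "C \<in> critical_curves c"
  shows "closure C \<subseteq> segment c"
proof (cases "fst c = 0")
  case True
  then obtain j where j: "c = (0, j)" "j \<in> {0, - 1}"
    using assms(1) horizontal_chain_cases by blast
  have "segment c = {0..1} \<times> {- of_int j}" using j by (auto simp: segment_def)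
  then have "closed (segment c)" by (simp add: closed_Times)
  then show ?thesis using assms(2) critical_curves_horizontal[OF j(2)] j(1) by simp
next
  case False
  then obtain a b where ab: "fraction_gap (chain_order c) a b" "chain_point c a \<in> segment c"
    "chain_point c b \<in> segment c" "C = chain_point c ` {a<..<b}"
    using assms(2) critical_curves_iff by blast
  then have "closure C = chain_point c ` {a..b}"
    by (simp add: fraction_gap_def closure_chain_point_image)
  then show ?thesis using chain_point_segment_between[OF ab(2,3)] by auto
qed

lemma chain_eqI:
  assumes "z \<in> segment c" "z \<in> segment c'" "w \<in> segment c" "w \<in> segment c'" "fst z \<noteq> fst w"
  shows "c = c'"
proof -
  have *: "snd z = of_int (fst c) * fst z - of_int (snd c)" "snd z = of_int (fst c') * fst z - of_int (snd c')"
    "snd w = of_int (fst c) * fst w - of_int (snd c)" "snd w = of_int (fst c') * fst w - of_int (snd c')"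
    using assms by (auto simp: segment_def)
  then have "(real_of_int (fst c) - of_int (fst c')) * (fst z - fst w) = 0" by (simp add: algebra_simps)
  then have "fst c = fst c'" using assms(5) by simp
  moreover from this have "snd c = snd c'" using * by simp
  ultimately show ?thesis by (simp add: prod_eq_iff)
qed

text \<open>Two points with different abscissas fix the line. On it, two gaps whose closures share
  two points overlap and hence agree; a horizontal chain has only one curve.\<close>

lemma critical_curve_eqI:
  assumes c: "is_chain c" "C \<in> critical_curves c" "is_chain c'" "C' \<in> critical_curves c'"
    and z: "z \<in> closure C" "z \<in> closure C'" "w \<in> closure C" "w \<in> closure C'" "fst z \<noteq> fst w"
  shows "c = c'" "C = C'"
proof -
  show cc: "c = c'"
    using chain_eqI[of z c c' w] z critical_curve_closure[OF c(1,2)] critical_curve_closure[OF c(3,4)] by blast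
  show "C = C'"
  proof (cases "fst c = 0")
    case True
    then obtain j where j: "c = (0, j)" "j \<in> {0, - 1}"
      using c(1) horizontal_chain_cases by blast
    then show ?thesis using c critical_curves_horizontal[OF j(2)] cc by auto
  next
    case False
    obtain a b where ab: "fraction_gap (chain_order c) a b" "C = chain_point c ` {a<..<b}"
      using c(2) critical_curves_iff[OF False] by blast
    obtain a' b' where ab': "fraction_gap (chain_order c) a' b'" "C' = chain_point c ` {a'<..<b'}"
      using c(4) critical_curves_iff[OF False] cc by blast
    have cl: "closure C = chain_point c ` {a..b}" "closure C' = chain_point c ` {a'..b'}"
      using ab ab' by (auto simp: fraction_gap_def closure_chain_point_image)
    then have "fst z \<in> {a..b}" "fst w \<in> {a..b}" "fst z \<in> {a'..b'}" "fst w \<in> {a'..b'}" using z by auto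
    then have "a < b'" "a' < b" using z(5) by auto
    then show ?thesis using fraction_gap_unique[OF ab(1) ab'(1)] ab(2) ab'(2) by simp
  qed
qed

lemma ex_quadrant_name: "(\<exists>Q. P Q) \<longleftrightarrow> P Q1 \<or> P Q2 \<or> P Q3 \<or> P Q4"
  by (metis quadrant_name.exhaust)

lemma quadrant_with_direction: "d \<in> {1, - 1} \<Longrightarrow> e \<in> {1, - 1} \<Longrightarrow> \<exists>Q. vdir Q = d \<and> hdir Q = e"
  unfolding ex_quadrant_name by (auto simp: vdir_def hdir_def)

context rational_critical
begin

text \<open>The description is legitimate by \<open>partner_unique\<close>. It lets
  \<open>side_curve\<close> name a curve by its chain and direction alone, without a choice of
  \<open>u\<close> and \<open>v\<close>.\<close>

definition partner_point :: "int \<Rightarrow> int \<Rightarrow> real" where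
  "partner_point I e = (THE t. \<exists>u v. partner I e u v \<and> t = of_int u / of_int v)"

definition side_curve :: "chain \<Rightarrow> int \<Rightarrow> point set" where
  "side_curve c e = chain_point c ` side (partner_point \<bar>fst c\<bar> e)"

lemma partner_point_eq: "partner I e u v \<Longrightarrow> partner_point I e = of_int u / of_int v"
  unfolding partner_point_def by (rule the_equality) (auto dest: partner_unique)

lemma nondominantD:
  assumes "c \<in> nondominant_chains centre"
  shows "is_chain c" "fst c * p - snd c * q = k" "q \<le> \<bar>fst c\<bar>" "fst c \<noteq> 0"
  using assms q_pos unfolding nondominant_iff by auto

text \<open>The bounds on \<open>k + vdir Q\<close> say that the neighbour on that side exists. The
  matching room in the horizontal direction then follows from
  \<open>nondominant_direction\<close>.\<close>

lemma adjacent_in_quadrant_iff: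
  assumes c: "c \<in> nondominant_chains centre"
  shows "C \<in> adjacent_curves centre c \<and> C \<subseteq> quadrant Q centre \<longleftrightarrow>
    sgn (fst c) = vdir Q * hdir Q \<and> 0 \<le> k + vdir Q \<and> k + vdir Q \<le> q \<and> C = side_curve c (hdir Q)"
proof
  note nd = nondominantD[OF c]
  assume C: "C \<in> adjacent_curves centre c \<and> C \<subseteq> quadrant Q centre"
  then obtain e u v where e: "e \<in> {1, - 1}" and P: "partner \<bar>fst c\<bar> e u v"
    and d: "0 \<le> k + sgn (fst c) * e" "k + sgn (fst c) * e \<le> q" and Ceq: "C = chain_point c ` side (of_int u / of_int v)"
    using adjacent_curve_cases[OF nd(2,3), of C] by metis
  have "hdir Q = e" "vdir Q = sgn (fst c) * e"
    using side_curve_subset_quadrant_iff[OF nd(2,3) P e] C Ceq by auto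
  then show "sgn (fst c) = vdir Q * hdir Q \<and> 0 \<le> k + vdir Q \<and> k + vdir Q \<le> q \<and> C = side_curve c (hdir Q)"
    using d Ceq P e by (auto simp: side_curve_def partner_point_eq)
next
  note nd = nondominantD[OF c]
  assume R: "sgn (fst c) = vdir Q * hdir Q \<and> 0 \<le> k + vdir Q \<and> k + vdir Q \<le> q \<and> C = side_curve c (hdir Q)"
  obtain u v where P: "partner \<bar>fst c\<bar> (hdir Q) u v" using partner_exists by blast
  have C: "C = chain_point c ` side (of_int u / of_int v)" using R P by (simp add: side_curve_def partner_point_eq)
  have v: "vdir Q = sgn (fst c) * hdir Q" using R hdir_cases[of Q] vdir_cases[of Q] by auto
  have h: "hdir Q = sgn (fst c) * vdir Q" using R hdir_cases[of Q] vdir_cases[of Q] by auto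
  have "0 \<le> p + hdir Q" "p + hdir Q \<le> q"
    using nondominant_direction[OF c vdir_cases[of Q]] R unfolding h[symmetric] by blast+
  moreover have "0 \<le> k + sgn (fst c) * hdir Q" "k + sgn (fst c) * hdir Q \<le> q" using R unfolding v[symmetric] by blast+
  ultimately show "C \<in> adjacent_curves centre c \<and> C \<subseteq> quadrant Q centre"
    using side_curve_critical(1)[OF nd(2,3) P hdir_cases]
      side_curve_subset_quadrant_iff[OF nd(2,3) P hdir_cases] v C by auto
qed

text \<open>Room for a step \<open>1 / q\<close> in both directions of the quadrant. By
  \<open>pencil_quadrants_eq\<close> this arithmetic condition singles out the pencils that are not
  missing.\<close>

definition quadrant_ok :: "quadrant_name \<Rightarrow> bool" where
  "quadrant_ok Q \<longleftrightarrow> 0 \<le> k + vdir Q \<and> k + vdir Q \<le> q \<and> 0 \<le> p + hdir Q \<and> p + hdir Q \<le> q"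

lemma side_chain_quadrant_ok:
  assumes c: "c \<in> nondominant_chains centre" and Q: "sgn (fst c) = vdir Q * hdir Q" "0 \<le> k + vdir Q" "k + vdir Q \<le> q"
  shows "quadrant_ok Q"
proof -
  have h: "hdir Q = sgn (fst c) * vdir Q" using Q(1) hdir_cases[of Q] vdir_cases[of Q] by auto
  then show ?thesis using nondominant_direction[OF c vdir_cases Q(2,3)] Q(2,3) unfolding quadrant_ok_def h[symmetric] by simp
qed

lemma pencil_iff:
  "C \<in> pencil centre Q \<longleftrightarrow> quadrant_ok Q \<and>
    (\<exists>c \<in> nondominant_chains centre. sgn (fst c) = vdir Q * hdir Q \<and> C = side_curve c (hdir Q))"
proof -
  have "C \<in> pencil centre Q \<longleftrightarrow> (\<exists>c \<in> nondominant_chains centre. C \<in> adjacent_curves centre c \<and> C \<subseteq> quadrant Q centre)"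
    by (auto simp: pencil_def)
  also have "\<dots> \<longleftrightarrow> (\<exists>c \<in> nondominant_chains centre. sgn (fst c) = vdir Q * hdir Q \<and> 0 \<le> k + vdir Q \<and> k + vdir Q \<le> q \<and> C = side_curve c (hdir Q))"
    using adjacent_in_quadrant_iff by (intro bex_cong refl)
  also have "\<dots> \<longleftrightarrow> quadrant_ok Q \<and>
    (\<exists>c \<in> nondominant_chains centre. sgn (fst c) = vdir Q * hdir Q \<and> C = side_curve c (hdir Q))"
    using side_chain_quadrant_ok by (auto simp: quadrant_ok_def)
  finally show ?thesis .
qed

text \<open>A curve of a pencil has just two Farey points, the centre and its far end over
  \<open>u / v\<close>; removing the centre leaves the far ends.\<close>

lemma pencil_farey_points_iff:
  "w \<in> pencil_farey_points centre Q \<longleftrightarrow> quadrant_ok Q \<and>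
    (\<exists>c \<in> nondominant_chains centre. \<exists>u v. sgn (fst c) = vdir Q * hdir Q \<and>
      partner \<bar>fst c\<bar> (hdir Q) u v \<and> w = chain_point c (of_int u / of_int v))"
  (is "?L \<longleftrightarrow> ?R")
proof -
  have fp: "curve_farey_points c (side_curve c (hdir Q)) - {centre} = {chain_point c (of_int u / of_int v)}"
    if c: "c \<in> nondominant_chains centre" and Q: "sgn (fst c) = vdir Q * hdir Q" "quadrant_ok Q"
      and P: "partner \<bar>fst c\<bar> (hdir Q) u v" for c u v
  proof -
    note nd = nondominantD[OF c]
    have v: "vdir Q = sgn (fst c) * hdir Q" using Q(1) hdir_cases[of Q] vdir_cases[of Q] by auto
    have "curve_farey_points c (side_curve c (hdir Q)) = {centre, chain_point c (of_int u / of_int v)}"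
      using side_curve_critical(2)[OF nd(2,3) P hdir_cases] Q(2) v
      by (simp add: side_curve_def partner_point_eq[OF P] quadrant_ok_def)
    moreover have "0 < of_int (hdir Q) * (of_int u / of_int v - abscissa)"
      using partner_side[of "chain_order c" "hdir Q" u v] P hdir_cases nd(3) by simp
    then have "chain_point c (of_int u / of_int v) \<noteq> centre" by (auto simp: chain_point_def)
    ultimately show ?thesis by auto
  qed
  show ?thesis
  proof
    assume ?L
    then obtain c C where c: "c \<in> nondominant_chains centre" "C \<in> critical_curves c" "C \<in> pencil centre Q"
      "w \<in> curve_farey_points c C" "w \<noteq> centre"
      by (auto simp: pencil_farey_points_def)
    then have "C \<in> adjacent_curves centre c \<and> C \<subseteq> quadrant Q centre"
      by (auto simp: pencil_def adjacent_curves_def)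
    then have Q: "sgn (fst c) = vdir Q * hdir Q" "0 \<le> k + vdir Q" "k + vdir Q \<le> q" "C = side_curve c (hdir Q)"
      using adjacent_in_quadrant_iff[OF c(1)] by auto
    have ok: "quadrant_ok Q" using side_chain_quadrant_ok c(1) Q by blast
    obtain u v where P: "partner \<bar>fst c\<bar> (hdir Q) u v" using partner_exists by blast
    show ?R using fp[OF c(1) Q(1) ok P] c Q ok P by blast
  next
    assume ?R
    then obtain c u v where c: "c \<in> nondominant_chains centre" "sgn (fst c) = vdir Q * hdir Q"
      "partner \<bar>fst c\<bar> (hdir Q) u v" "w = chain_point c (of_int u / of_int v)" and ok: "quadrant_ok Q" by blast
    have C: "side_curve c (hdir Q) \<in> pencil centre Q" unfolding pencil_iff using ok c by blast
    have "side_curve c (hdir Q) \<in> critical_curves c"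
      using adjacent_in_quadrant_iff[OF c(1), of _ Q] ok c(2) by (auto simp: adjacent_curves_def quadrant_ok_def)
    then show ?L using fp[OF c(1,2) ok c(3)] C c(1,4) unfolding pencil_farey_points_def by blast
  qed
qed

lemma quadrant_ok_chain:
  assumes "quadrant_ok Q"
  shows "\<exists>c \<in> nondominant_chains centre. sgn (fst c) = vdir Q * hdir Q \<and> B \<le> \<bar>fst c\<bar>"
  using assms unfolding quadrant_ok_def by (intro nondominant_unbounded vdir_cases hdir_cases) auto

lemma pencil_quadrants_eq: "pencil_quadrants centre = {Q. quadrant_ok Q}"
proof -
  have "pencil centre Q \<noteq> {} \<longleftrightarrow> quadrant_ok Q" for Q
    using quadrant_ok_chain[of Q 0] by (auto simp: ex_in_conv[symmetric] pencil_iff simp del: ex_in_conv)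
  then show ?thesis by (simp add: pencil_quadrants_def)
qed

lemma infinite_pencil:
  assumes "quadrant_ok Q"
  shows "infinite (pencil centre Q)"
proof -
  let ?A = "{c \<in> nondominant_chains centre. sgn (fst c) = vdir Q * hdir Q}"
  have "infinite ?A"
  proof
    assume fin: "finite ?A"
    define B where "B = Max ((\<lambda>c. \<bar>fst c\<bar>) ` ?A) + 1"
    obtain c where c: "c \<in> ?A" "B \<le> \<bar>fst c\<bar>" using quadrant_ok_chain[OF assms, of B] by blast
    then have "\<bar>fst c\<bar> \<le> Max ((\<lambda>c. \<bar>fst c\<bar>) ` ?A)" using fin by (intro Max_ge) auto
    then show False using c by (simp add: B_def)
  qed
  \<comment> \<open>Chains carrying the same curve share the centre and a point with another
    abscissa, hence the slope.\<close>
  moreover have "inj_on (\<lambda>c. side_curve c (hdir Q)) ?A"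
  proof (rule inj_onI)
    fix c c' assume c: "c \<in> ?A" "c' \<in> ?A" and eq: "side_curve c (hdir Q) = side_curve c' (hdir Q)"
    note nd = nondominantD[of c] and nd' = nondominantD[of c']
    obtain u v where P: "partner (int (chain_order c)) (hdir Q) u v" using partner_exists by blast
    then obtain t where t: "t \<in> side (partner_point \<bar>fst c\<bar> (hdir Q))"
      using side_nonempty[OF P hdir_cases] nd c by (auto simp: partner_point_eq)
    then have "0 < of_int (hdir Q) * (t - abscissa)"
      using side_direction[OF P hdir_cases, of t] P nd c by (auto simp: partner_point_eq)
    then have ta: "t \<noteq> abscissa" by auto
    have "chain_point c t \<in> side_curve c (hdir Q)" using t by (simp add: side_curve_def)
    then have "chain_point c t = chain_point c' t" unfolding eq by (auto simp: side_curve_def chain_point_def)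
    then have "of_int (fst c) * (t - abscissa) = of_int (fst c') * (t - abscissa)"
      using height_diff[of c t] height_diff[of c' t] nd nd' c by auto
    then have "fst c = fst c'" using ta by simp
    moreover from this have "snd c = snd c'" using nd(2) nd'(2) c through_unique by auto
    ultimately show "c = c'" by (simp add: prod_eq_iff)
  qed
  ultimately have "infinite ((\<lambda>c. side_curve c (hdir Q)) ` ?A)" using finite_imageD by blast
  moreover have "(\<lambda>c. side_curve c (hdir Q)) ` ?A \<subseteq> pencil centre Q" using pencil_iff assms by blast
  ultimately show ?thesis using finite_subset by blast
qed

text \<open>The far end is at horizontal distance \<open>1 / (v * q)\<close> from the centre, so
  different \<open>v\<close> give different abscissas. These two points are what pins down the curve
  containing a pencil's ends.\<close>

lemma two_pencil_farey_points:
  assumes "quadrant_ok Q"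
  obtains z w where "z \<in> pencil_farey_points centre Q" "w \<in> pencil_farey_points centre Q" "fst z \<noteq> fst w"
proof -
  obtain c where c: "c \<in> nondominant_chains centre" "sgn (fst c) = vdir Q * hdir Q"
    using quadrant_ok_chain[OF assms] by blast
  obtain c' where c': "c' \<in> nondominant_chains centre" "sgn (fst c') = vdir Q * hdir Q" "\<bar>fst c\<bar> + q \<le> \<bar>fst c'\<bar>"
    using quadrant_ok_chain[OF assms] by blast
  obtain u v where P: "partner \<bar>fst c\<bar> (hdir Q) u v" using partner_exists by blast
  obtain u' v' where P': "partner \<bar>fst c'\<bar> (hdir Q) u' v'" using partner_exists by blast
  \<comment> \<open>The orders differ by at least \<open>q\<close>, the length of the windows, so
    the windows for \<open>v\<close> and \<open>v'\<close> are disjoint.\<close>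
  have v: "0 < v" "v < v'" using P P' c'(3) nondominantD(3)[OF c(1)] by (auto simp: partner_def)
  then have "of_int v * of_int q < (of_int v' * of_int q :: real)" using q_pos by simp
  moreover have "0 < (of_int v * of_int q :: real)" using v q_pos by simp
  ultimately have "of_int (hdir Q) / (of_int v * of_int q) \<noteq> (of_int (hdir Q) / (of_int v' * of_int q) :: real)"
    using hdir_cases[of Q] by (auto simp: frac_eq_eq)
  then have "of_int u / of_int v \<noteq> (of_int u' / of_int v' :: real)"
    using partner_diff[OF P v(1)] partner_diff[OF P'] v by auto
  then show thesis
    using that[of "chain_point c (of_int u / of_int v)" "chain_point c' (of_int u' / of_int v')"]
      assms c c' P P' unfolding pencil_farey_points_iff by auto
qed

end

section \<open>Dominant curves of the neighbours\<close>

lemma chain_has_quadrant_sign: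
  "sgn (fst c) = vdir Q * hdir Q \<Longrightarrow> chain_has_sign (quadrant_sign Q) c"
  by (cases Q) (auto simp: vdir_def hdir_def quadrant_sign_def chain_has_sign_def sgn_if split: if_splits)

lemma quadrant_sign_eq: "quadrant_sign Q = (if vdir Q * hdir Q = 1 then Positive else Negative)"
  by (cases Q) (auto simp: vdir_def hdir_def quadrant_sign_def)

context rational_critical
begin

text \<open>With \<open>a\<close> inverse to \<open>p\<close> modulo \<open>q\<close>, the
  congruence for \<open>W\<close> selects the class of \<open>s * h * a\<close>, and its remainder
  modulo \<open>q\<close> is taken. It is 0, giving a horizontal line, exactly when \<open>q\<close>
  divides \<open>h\<close>.\<close>

lemma line_through_exists:
  assumes s: "s \<in> {1, - 1}"
  obtains W J where "0 \<le> W" "W < q" "(s * W) * p - J * q = h"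
proof -
  obtain a b where ab: "a * p + b * q = 1"
    using bezout_int[of p q] coprime_pq by (metis coprime_imp_gcd_eq_1)
  define D where "D = (s * h * a) div q"
  define W where "W = (s * h * a) mod q"
  have W: "W = s * h * a - q * D" by (simp add: W_def D_def minus_mult_div_eq_mod)
  have "s * s = 1" using s by auto
  then have "(s * W) * p - (- h * b - s * D * p) * q = h * (a * p + b * q)"
    unfolding W by (simp add: algebra_simps)
  then show thesis using that[of W "- h * b - s * D * p"] ab q_pos by (simp add: W_def)
qed

text \<open>At abscissa \<open>u / v\<close> the slope can be lowered by \<open>s * v\<close> at the
  cost of the integer \<open>s * u\<close> in the intercept. The resulting line has slope
  \<open>s * (order - v)\<close> and passes through the neighbour, and the residue class modulo
  \<open>q\<close> identifies it with the given one.\<close>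

lemma partner_point_on_line:
  assumes thr: "fst c * p - snd c * q = k" and order: "q \<le> \<bar>fst c\<bar>" and s: "sgn (fst c) = d * e" "e \<in> {1, - 1}"
    and P: "partner \<bar>fst c\<bar> e u v" and W: "0 \<le> W" "W < q" "(d * e * W) * p - J * q = k + d"
  shows "chain_point c (of_int u / of_int v) = chain_point (d * e * W, J) (of_int u / of_int v)"
proof -
  define s where "s = d * e"
  have c0: "fst c \<noteq> 0" using order q_pos by auto
  have s1: "s \<in> {1, - 1}" using s c0 unfolding s_def by (auto simp: sgn_if split: if_splits)
  have d: "d = s * e" using s(2) by (auto simp: s_def)
  have i: "fst c = s * \<bar>fst c\<bar>" using s(1) unfolding s_def by (metis sgn_mult_abs)
  have v: "\<bar>fst c\<bar> - q < v" "v \<le> \<bar>fst c\<bar>" "u * q - p * v = e" using P by (auto simp: partner_def)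
  then have v0: "v > 0" using order by simp
  define W' where "W' = \<bar>fst c\<bar> - v"
  have "(s * W') * p - (snd c - s * u) * q = (s * \<bar>fst c\<bar>) * p - snd c * q + s * (u * q - p * v)"
    by (simp add: W'_def algebra_simps)
  also have "\<dots> = k + d" using i thr v(3) d by simp
  finally have W': "(s * W') * p - (snd c - s * u) * q = k + d" .
  have "(s * (W - W')) * p = (J - (snd c - s * u)) * q" using W(3) W' unfolding s_def[symmetric] by (simp add: algebra_simps)
  then have "q dvd s * (W - W')" using dvd_mult_p by (metis dvd_triv_right)
  then have "q dvd W - W'" using s1 by (auto simp: dvd_diff_commute)
  moreover have "\<bar>W - W'\<bar> < q" using W v by (auto simp: W'_def)
  ultimately have WW: "W = W'" by (metis dvd_abs_iff zdvd_not_zless zero_less_abs_iff eq_iff_diff_eq_0)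
  have "J * q = (snd c - s * u) * q" using W(3)[folded s_def, unfolded WW] W' by linarith
  then have J: "J = snd c - s * u" using q_pos by simp
  have "\<bar>fst c\<bar> = W + v" using WW by (simp add: W'_def)
  with i have "fst c = s * (W + v)" by simp
  then have "fst c = s * W + s * v" by (simp only: distrib_left)
  then have "real_of_int (fst c) = of_int (s * W) + of_int s * of_int v" by (metis of_int_add of_int_mult)
  then show ?thesis unfolding chain_point_def J s_def[symmetric] using v0 by (simp add: algebra_simps)
qed

lemma dominant_curve_interior:
  assumes k: "0 < k" "k < q" and dom: "dominant_chain s centre c"
  obtains a b where "fraction_gap (chain_order c) a b" "a < abscissa" "abscissa < b"
    "chain_point c a \<in> segment c" "chain_point c b \<in> segment c"
    "dominant_curves_on centre c = {chain_point c ` {a<..<b}}" "centre \<in> rel_interior (chain_point c ` {a<..<b})"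
proof -
  have c: "fst c * p - snd c * q = k" "fst c \<noteq> 0" "\<bar>fst c\<bar> < q"
    using dom dominant_interior_iff[OF k] by auto
  have z: "centre = chain_point c abscissa" using centre_eq_chain_point c(1) .
  have zs: "chain_point c abscissa \<in> segment c" using on_chain_iff c(1) z by metis
  have "abscissa \<notin> fractions_upto (chain_order c)" using abscissa_in_fractions_iff c(3) by simp
  then obtain a b where ab: "fraction_gap (chain_order c) a b" "a < abscissa" "abscissa < b"
    using fraction_gap_around[of abscissa "chain_order c"] c(2) by auto
  have s: "chain_point c a \<in> segment c" "chain_point c b \<in> segment c"
    using gap_in_segment[OF c(2) ab zs] ab by auto
  have "dominant_curves_on centre c = {C \<in> critical_curves c. centre \<in> C}"
    using centre_snd_iff k by (auto simp: dominant_curves_on_def end_point_def)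
  also have "\<dots> = {chain_point c ` {a<..<b}}"
  proof (intro subset_antisym subsetI)
    fix C assume "C \<in> {C \<in> critical_curves c. centre \<in> C}"
    then obtain a' b' where ab': "fraction_gap (chain_order c) a' b'" "C = chain_point c ` {a'<..<b'}" "centre \<in> C"
      using critical_curves_iff[OF c(2)] by blast
    then have "a' < abscissa" "abscissa < b'" unfolding z by auto
    then show "C \<in> {chain_point c ` {a<..<b}}"
      using fraction_gap_unique[OF ab(1) ab'(1)] ab ab'(2) by auto
  next
    fix C assume "C \<in> {chain_point c ` {a<..<b}}"
    then show "C \<in> {C \<in> critical_curves c. centre \<in> C}"
      using critical_curves_iff[OF c(2)] ab s unfolding z by auto
  qed
  finally have D: "dominant_curves_on centre c = {chain_point c ` {a<..<b}}" .
  have "centre \<in> rel_interior (chain_point c ` {a<..<b})"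
    using ab by (simp add: rel_interior_chain_point_image rel_interior_open z)
  then show thesis using that ab s D by blast
qed

lemma dominant_curves_on_horizontal:
  assumes "dominant_chain s centre c" "fst c = 0"
  shows "dominant_curves_on centre c = {segment c}" "centre \<in> segment c"
proof -
  consider (int) "0 < k" "k < q" | (bot) "k = 0" | (top) "k = q" using k_bounds by linarith
  then have c: "c = (0, 0) \<and> k = 0 \<or> c = (0, - 1) \<and> k = q"
    using assms dominant_interior_iff dominant_bottom_iff dominant_top_iff q_pos
    by cases (auto split: chain_sign.splits)
  then show z: "centre \<in> segment c" using on_chain_iff[of c] by auto
  then show "dominant_curves_on centre c = {segment c}"
    using c critical_curves_horizontal[of "snd c"] by (auto simp: dominant_curves_on_def end_point_def)
qed

lemma dominant_chain_unique_interior: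
  assumes k: "0 < k" "k < q" and c: "dominant_chain s centre c" "dominant_chain s' centre c'" "sgn (fst c) = sgn (fst c')"
  shows "c = c'"
proof -
  have *: "fst c * p - snd c * q = k" "\<bar>fst c\<bar> < q" "fst c' * p - snd c' * q = k" "\<bar>fst c'\<bar> < q" "fst c \<noteq> 0" "fst c' \<noteq> 0"
    using c dominant_interior_iff[OF k] by auto
  have "q dvd fst c - fst c'" using through_congruent * by blast
  moreover have "\<bar>fst c - fst c'\<bar> < q" using * c(3) by (auto simp: sgn_if split: if_splits)
  ultimately have "fst c = fst c'" by (metis dvd_abs_iff zdvd_not_zless zero_less_abs_iff eq_iff_diff_eq_0)
  then show ?thesis using * through_unique by (metis prod_eq_iff)
qed

text \<open>The line of the far ends has slope \<open>s * W\<close> and contains the neighbour. If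
  \<open>W = 0\<close>, the neighbour is on an edge and its horizontal chain is a single curve, so
  lying on the segment suffices. Otherwise \<open>q\<close> does not divide
  \<open>k + vdir Q\<close>, the neighbour is interior, and \<open>W < q\<close> makes the chain
  dominant.\<close>

lemma pencil_dominating:
  assumes ok: "quadrant_ok Q"
  defines "z \<equiv> (abscissa, of_int (k + vdir Q) / of_int q)"
  obtains \<sigma> c C where "dominant_chain \<sigma> z c" "C \<in> dominant_curves_on z c" "pencil_in_curve centre Q C"
    "fst c * p - snd c * q = k + vdir Q" "fst c = 0 \<or> sgn (fst c) = vdir Q * hdir Q"
    "0 < k + vdir Q \<and> k + vdir Q < q \<Longrightarrow> fst c \<noteq> 0"
proof -
  interpret N: rational_critical p q "k + vdir Q"
    using ok q_pos coprime_pq p_bounds by unfold_locales (auto simp: quadrant_ok_def)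
  define s where "s = vdir Q * hdir Q"
  have s: "s \<in> {1, - 1}" using vdir_cases[of Q] hdir_cases[of Q] by (auto simp: s_def)
  obtain W J where W: "0 \<le> W" "W < q" "(s * W) * p - J * q = k + vdir Q"
    using line_through_exists[OF s] by blast
  define c where "c = (s * W, J)"
  have thr: "fst c * p - snd c * q = k + vdir Q" using W by (simp add: c_def)
  have points: "\<exists>c' u v. c' \<in> nondominant_chains centre \<and> partner \<bar>fst c'\<bar> (hdir Q) u v \<and>
      w = chain_point c' (of_int u / of_int v) \<and> w = chain_point c (of_int u / of_int v) \<and> w \<in> segment c'"
    if w: "w \<in> pencil_farey_points centre Q" for w
  proof -
    obtain c' u v where c': "c' \<in> nondominant_chains centre" "sgn (fst c') = vdir Q * hdir Q"
      "partner \<bar>fst c'\<bar> (hdir Q) u v" "w = chain_point c' (of_int u / of_int v)"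
      using w unfolding pencil_farey_points_iff by blast
    note nd = nondominantD[OF c'(1)]
    have "w = chain_point c (of_int u / of_int v)"
      using partner_point_on_line[OF nd(2,3) c'(2) hdir_cases c'(3) W(1,2), of J] W(3) c'(4) by (simp add: s_def c_def)
    moreover have "vdir Q = sgn (fst c') * hdir Q" using c'(2) hdir_cases[of Q] vdir_cases[of Q] by auto
    then have "w \<in> segment c'"
      using partner_point_in_segment[OF nd(2,3) c'(3) hdir_cases] ok c'(4) by (auto simp: quadrant_ok_def)
    ultimately show ?thesis using c' by blast
  qed
  show thesis
  proof (cases "W = 0")
    case True
    then have c0: "fst c = 0" by (simp add: c_def)
    have kq: "k + vdir Q = - J * q" using W True by simp
    have "0 \<le> k + vdir Q" "k + vdir Q \<le> q" using ok by (auto simp: quadrant_ok_def)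
    then have "0 * q \<le> (- J) * q" "(- J) * q \<le> 1 * q" using kq by auto
    then have "0 \<le> - J" "- J \<le> 1" using q_pos by (simp_all only: mult_le_cancel_right_pos)
    then have J: "J = 0 \<or> J = - 1" by auto
    have dom: "\<exists>\<sigma>. dominant_chain \<sigma> z c"
    proof (cases "J = 0")
      case True
      then show ?thesis using N.dominant_bottom_iff[of Positive c] kq c0 unfolding z_def
        by (intro exI[of _ Positive]) (auto simp: c_def is_chain_def \<open>W = 0\<close>)
    next
      case False
      then show ?thesis using J N.dominant_top_iff[of Negative c] kq c0 unfolding z_def
        by (intro exI[of _ Negative]) (auto simp: c_def is_chain_def \<open>W = 0\<close>)
    qed
    then obtain \<sigma> where dom: "dominant_chain \<sigma> z c" by blast
    \<comment> \<open>The point is on the line of \<open>c\<close>; that it is in the unit square is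
      known from its own chain \<open>c'\<close>.\<close>
    have "w \<in> segment c" if w: "w \<in> pencil_farey_points centre Q" for w
    proof -
      obtain c' t where "w = chain_point c t" "w \<in> segment c'" using points[OF w] by blast
      then show ?thesis by (auto simp: chain_point_def segment_def)
    qed
    then have "pencil_in_curve centre Q (segment c)"
      using closure_subset by (auto simp: pencil_in_curve_def)
    moreover have "segment c \<in> dominant_curves_on z c"
      using N.dominant_curves_on_horizontal dom c0 unfolding z_def by blast
    moreover have "\<not> (0 < k + vdir Q \<and> k + vdir Q < q)" using kq J by auto
    ultimately show thesis using that dom thr c0 by blast
  next
    case False
    have int: "0 < k + vdir Q" "k + vdir Q < q"
    proof -
      have "\<not> q dvd W" using False W by (intro zdvd_not_zless) auto
      then have "\<not> q dvd s * W" using s by auto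
      then have "\<not> q dvd k + vdir Q" using W(3) dvd_mult_p by (metis dvd_diff dvd_triv_right diff_add_cancel dvd_add)
      then have "k + vdir Q \<noteq> 0" "k + vdir Q \<noteq> q" by auto
      then show "0 < k + vdir Q" "k + vdir Q < q" using ok by (auto simp: quadrant_ok_def)
    qed
    define \<sigma> where "\<sigma> = (if s = 1 then Positive else Negative)"
    have abs: "\<bar>fst c\<bar> = W" and c0: "fst c \<noteq> 0" and sg: "sgn (fst c) = s"
      using s W False by (auto simp: c_def abs_mult sgn_mult)
    have "chain_has_sign \<sigma> c" using s W by (auto simp: \<sigma>_def chain_has_sign_def c_def)
    then have dom: "dominant_chain \<sigma> z c"
      unfolding z_def N.dominant_interior_iff[OF int] using abs c0 thr W by auto
    obtain a b where ab: "fraction_gap (chain_order c) a b" "a < abscissa" "abscissa < b"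
      "dominant_curves_on z c = {chain_point c ` {a<..<b}}"
      using N.dominant_curve_interior[OF int dom[unfolded z_def]] unfolding z_def by metis
    have fr: "a \<in> fractions_upto (chain_order c)" "b \<in> fractions_upto (chain_order c)"
      using ab(1) by (auto simp: fraction_gap_def)
    have "w \<in> chain_point c ` {a..b}" if w: "w \<in> pencil_farey_points centre Q" for w
    proof -
      obtain c' u v where c': "c' \<in> nondominant_chains centre" "partner \<bar>fst c'\<bar> (hdir Q) u v"
        "w = chain_point c (of_int u / of_int v)" using points[OF w] by blast
      have v0: "v > 0" using c'(2) nondominantD(3)[OF c'(1)] by (auto simp: partner_def)
      have far: "\<not> q + v \<le> int (chain_order c)" using abs W v0 by simp
      have no: "\<not> (min abscissa (of_int u / of_int v) < t \<and> t < max abscissa (of_int u / of_int v))"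
        if "t \<in> fractions_upto (chain_order c)" for t
        using order_between_partners[OF _ hdir_cases v0 that] far c'(2) by (auto simp: partner_def)
      have "a \<le> of_int u / of_int v" "of_int u / of_int v \<le> b"
        using no[OF fr(1)] no[OF fr(2)] ab(2,3) by (auto simp: min_def max_def split: if_splits)
      then show ?thesis using c'(3) by auto
    qed
    moreover have "closure (chain_point c ` {a<..<b}) = chain_point c ` {a..b}"
      using ab(2,3) by (simp add: closure_chain_point_image)
    ultimately have "pencil_in_curve centre Q (chain_point c ` {a<..<b})" by (auto simp: pencil_in_curve_def)
    then show thesis using that[OF dom] ab(4) thr c0 sg by (auto simp: s_def)
  qed
qed

lemma dominant_curves_on_critical: "C \<in> dominant_curves_on z c \<Longrightarrow> C \<in> critical_curves c"
  by (simp add: dominant_curves_on_def)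

lemma pencil_in_curve_unique:
  assumes "quadrant_ok Q" "is_chain c" "C \<in> critical_curves c" "is_chain c'" "C' \<in> critical_curves c'"
    and "pencil_in_curve centre Q C" "pencil_in_curve centre Q C'"
  shows "c = c'" "C = C'"
proof -
  obtain z w where zw: "z \<in> pencil_farey_points centre Q" "w \<in> pencil_farey_points centre Q" "fst z \<noteq> fst w"
    using two_pencil_farey_points[OF assms(1)] .
  then have "z \<in> closure C" "z \<in> closure C'" "w \<in> closure C" "w \<in> closure C'"
    using assms(6,7) by (auto simp: pencil_in_curve_def)
  then show "c = c'" "C = C'" using critical_curve_eqI[OF assms(2-5) _ _ _ _ zw(3)] by auto
qed

lemma neighbours_iff:
  "z \<in> neighbours centre \<longleftrightarrow> (\<exists>d \<in> {1, - 1}. 0 \<le> k + d \<and> k + d \<le> q \<and> z = (abscissa, of_int (k + d) / of_int q))"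
proof -
  have "den (fst centre) = q" using lowest_terms_divide[OF coprime_pq q_pos] by simp
  moreover have "k \<noteq> q \<longleftrightarrow> k + 1 \<le> q" "k \<noteq> 0 \<longleftrightarrow> 0 \<le> k - 1" using k_bounds by auto
  ultimately show ?thesis
    using k_bounds centre_snd_iff
    by (auto simp: neighbours_def add_divide_distrib diff_divide_distrib)
qed

lemma interior_dominant_exists:
  fixes s :: int
  assumes k: "0 < k" "k < q" and s: "s \<in> {1, - 1}"
  obtains c where "dominant_chain (if s = 1 then Positive else Negative) centre c"
proof -
  obtain W J where W: "0 \<le> W" "W < q" "(s * W) * p - J * q = k"
    using line_through_exists[OF s] by blast
  have "W \<noteq> 0"
  proof
    assume "W = 0"
    then have "q dvd k" using W(3) by (metis dvd_minus_iff dvd_triv_right mult_zero_left mult_zero_right diff_0)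
    then show False using k zdvd_not_zless by blast
  qed
  then have "dominant_chain (if s = 1 then Positive else Negative) centre (s * W, J)"
    using W s unfolding dominant_interior_iff[OF k] by (auto simp: chain_has_sign_def abs_mult sgn_mult)
  then show thesis using that by blast
qed

lemma dominant_curves_of_interior:
  assumes k: "0 < k" "k < q"
  shows "\<exists>C. dominant_curves_of s centre = {C} \<and> centre \<in> rel_interior C"
proof -
  define t :: int where "t = (if s = Positive then 1 else - 1)"
  have "t \<in> {1, - 1}" and s: "s = (if t = 1 then Positive else Negative)" by (cases s; simp add: t_def)+
  then obtain c where "dominant_chain (if t = 1 then Positive else Negative) centre c"
    using interior_dominant_exists[OF k] by blast
  then have dom: "dominant_chain s centre c" unfolding s[symmetric] .
  have "c' = c" if "dominant_chain s centre c'" for c'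
  proof -
    have "sgn (fst c') = sgn (fst c)"
      using that dom unfolding dominant_interior_iff[OF k] by (cases s) (auto simp: chain_has_sign_def sgn_if)
    then show ?thesis using dominant_chain_unique_interior[OF k that dom] by simp
  qed
  then have "dominant_curves_of s centre = dominant_curves_on centre c"
    using dom unfolding dominant_curves_of_def by blast
  then show ?thesis using dominant_curve_interior[OF k dom] by metis
qed

section \<open>Counting neighbours, pencils and adjacent curves\<close>

lemma card_neighbours:
  shows "0 < k \<Longrightarrow> k < q \<Longrightarrow> card (neighbours centre) = 2"
    and "k = 0 \<or> k = q \<Longrightarrow> card (neighbours centre) = 1"
proof -
  show "card (neighbours centre) = 2" if "0 < k" "k < q"
  proof -
    have "neighbours centre = {(abscissa, of_int (k + 1) / of_int q), (abscissa, of_int (k - 1) / of_int q)}"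
      unfolding set_eq_iff neighbours_iff using that by auto
    moreover have "of_int (k + 1) / of_int q \<noteq> (of_int (k - 1) / of_int q :: real)" using q_pos by simp
    ultimately show ?thesis by simp
  qed
  show "card (neighbours centre) = 1" if "k = 0 \<or> k = q"
  proof -
    have "neighbours centre = {(abscissa, of_int (if k = 0 then k + 1 else k - 1) / of_int q)}"
      unfolding set_eq_iff neighbours_iff using that q_pos by auto
    then show ?thesis by simp
  qed
qed

lemma pencil_quadrants_interior:
  assumes "0 < k" "k < q"
  shows "pencil_quadrants centre = {Q1, Q2, Q3, Q4}"
proof -
  have "0 < p" "p < q" using p_interior assms by auto
  then have "quadrant_ok Q" for Q using assms vdir_cases[of Q] hdir_cases[of Q] by (auto simp: quadrant_ok_def)
  then show ?thesis using quadrant_name.exhaust by (auto simp: pencil_quadrants_eq)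
qed

lemma pencil_quadrants_edge:
  assumes k: "k = 0 \<or> k = q"
  shows "if abscissa \<in> {0, 1} then \<exists>Q. pencil_quadrants centre = {Q}
    else \<exists>Q Q'. quadrant_sign Q \<noteq> quadrant_sign Q' \<and> pencil_quadrants centre = {Q, Q'}"
proof -
  have ok: "quadrant_ok Q \<longleftrightarrow> vdir Q = (if k = 0 then 1 else - 1) \<and> (hdir Q = 1 \<and> p \<noteq> q \<or> hdir Q = - 1 \<and> p \<noteq> 0)" for Q
    using k q_pos p_bounds vdir_cases[of Q] hdir_cases[of Q] by (auto simp: quadrant_ok_def)
  have pq: "p \<noteq> 0 \<or> p \<noteq> q" using q_pos by auto
  have x: "abscissa \<in> {0, 1} \<longleftrightarrow> p = 0 \<or> p = q" using q_pos by auto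
  obtain R where R: "vdir R = (if k = 0 then 1 else - 1)" "hdir R = 1"
    using quadrant_with_direction[of "if k = 0 then 1 else - 1" 1] by fastforce
  obtain L where L: "vdir L = (if k = 0 then 1 else - 1)" "hdir L = - 1"
    using quadrant_with_direction[of "if k = 0 then 1 else - 1" "- 1"] by fastforce
  have "quadrant_ok Q \<longleftrightarrow> Q = R \<and> p \<noteq> q \<or> Q = L \<and> p \<noteq> 0" for Q
    unfolding ok using R L quadrant_eqI by metis
  then have PQ: "pencil_quadrants centre = {Q. Q = R \<and> p \<noteq> q \<or> Q = L \<and> p \<noteq> 0}" by (simp add: pencil_quadrants_eq)
  show ?thesis
  proof (cases "p = 0 \<or> p = q")
    case True
    then have "pencil_quadrants centre = {if p = 0 then R else L}" using PQ pq by auto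
    then show ?thesis using True x by auto
  next
    case False
    then have "pencil_quadrants centre = {R, L}" using PQ by auto
    moreover have "quadrant_sign R \<noteq> quadrant_sign L" using R L by (auto simp: quadrant_sign_eq)
    ultimately show ?thesis using False x by auto
  qed
qed

text \<open>The horizontal room is a hypothesis because the result serves twice: for non-dominant
  chains, and for the dominant chain of order \<open>q\<close> that ends at a centre on an
  edge.\<close>

lemma adjacent_curves_eq:
  assumes thr: "fst c * p - snd c * q = k" and order: "q \<le> \<bar>fst c\<bar>"
    and ok: "\<And>e. e \<in> {1, - 1} \<Longrightarrow> 0 \<le> k + sgn (fst c) * e \<Longrightarrow> k + sgn (fst c) * e \<le> q \<Longrightarrow> 0 \<le> p + e \<and> p + e \<le> q"
  shows "adjacent_curves centre c = side_curve c ` {e \<in> {1, - 1}. 0 \<le> k + sgn (fst c) * e \<and> k + sgn (fst c) * e \<le> q}"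
proof (intro subset_antisym subsetI)
  fix C assume "C \<in> adjacent_curves centre c"
  then obtain e u v where "e \<in> {1, - 1}" "partner \<bar>fst c\<bar> e u v"
    "0 \<le> k + sgn (fst c) * e" "k + sgn (fst c) * e \<le> q" "C = chain_point c ` side (of_int u / of_int v)"
    by (rule adjacent_curve_cases[OF thr order])
  then show "C \<in> side_curve c ` {e \<in> {1, - 1}. 0 \<le> k + sgn (fst c) * e \<and> k + sgn (fst c) * e \<le> q}"
    by (intro image_eqI[of _ _ e]) (auto simp: side_curve_def partner_point_eq)
next
  fix C assume "C \<in> side_curve c ` {e \<in> {1, - 1}. 0 \<le> k + sgn (fst c) * e \<and> k + sgn (fst c) * e \<le> q}"
  then obtain e where e: "e \<in> {1, - 1}" "0 \<le> k + sgn (fst c) * e" "k + sgn (fst c) * e \<le> q" "C = side_curve c e" by blast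
  obtain u v where P: "partner \<bar>fst c\<bar> e u v" using partner_exists by blast
  show "C \<in> adjacent_curves centre c"
    using side_curve_critical(1)[OF thr order P e(1) _ _ e(2,3)] ok[OF e(1-3)] e(4) P
    by (simp add: side_curve_def partner_point_eq)
qed

lemma nondominant_adjacent_curves:
  assumes "c \<in> nondominant_chains centre"
  shows "adjacent_curves centre c = side_curve c ` {e \<in> {1, - 1}. 0 \<le> k + sgn (fst c) * e \<and> k + sgn (fst c) * e \<le> q}"
proof (rule adjacent_curves_eq)
  note nd = nondominantD[OF assms]
  show "fst c * p - snd c * q = k" "q \<le> \<bar>fst c\<bar>" using nd by auto
  fix e :: int assume e: "e \<in> {1, - 1}" "0 \<le> k + sgn (fst c) * e" "k + sgn (fst c) * e \<le> q"
  have "sgn (fst c) * e \<in> {1, - 1}" "sgn (fst c) * (sgn (fst c) * e) = e" using e(1) nd(4) by (auto simp: sgn_if)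
  then show "0 \<le> p + e \<and> p + e \<le> q"
    using nondominant_direction[OF assms, of "sgn (fst c) * e"] e by auto
qed

lemma side_curve_in_pencil:
  assumes c: "c \<in> nondominant_chains centre" and e: "e \<in> {1, - 1}" "0 \<le> k + sgn (fst c) * e" "k + sgn (fst c) * e \<le> q"
    and Q: "hdir Q = e" "vdir Q = sgn (fst c) * e"
  shows "side_curve c e \<in> pencil centre Q"
proof -
  have "sgn (fst c) = vdir Q * hdir Q" using Q e(1) by auto
  moreover have "quadrant_ok Q" using side_chain_quadrant_ok[OF c calculation] Q e by simp
  ultimately show ?thesis using c Q pencil_iff by blast
qed

text \<open>The vertical direction is \<open>sgn (fst c) * e\<close>, so \<open>e = 1\<close> and
  \<open>e = - 1\<close> put one curve in each of two opposite quadrants; the curves differ because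
  the quadrant determines \<open>e\<close>.\<close>

lemma adjacent_curves_interior:
  assumes k: "0 < k" "k < q" and c: "c \<in> nondominant_chains centre"
  shows "\<exists>C C'. C \<noteq> C' \<and> adjacent_curves centre c = {C, C'} \<and>
          (if fst c > 0 then C \<in> pencil centre Q1 \<and> C' \<in> pencil centre Q3
           else C \<in> pencil centre Q2 \<and> C' \<in> pencil centre Q4)"
proof -
  note nd = nondominantD[OF c]
  have all: "0 \<le> k + sgn (fst c) * e \<and> k + sgn (fst c) * e \<le> q" if "e \<in> {1, - 1}" for e
    using k that by (auto simp: sgn_if)
  then have "{e \<in> {1, - 1}. 0 \<le> k + sgn (fst c) * e \<and> k + sgn (fst c) * e \<le> q} = {1, - 1}" by blast
  then have adj: "adjacent_curves centre c = {side_curve c 1, side_curve c (- 1)}"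
    using nondominant_adjacent_curves[OF c] by simp
  have ne: "side_curve c 1 \<noteq> side_curve c (- 1)"
  proof
    assume eq: "side_curve c 1 = side_curve c (- 1)"
    obtain u v where P: "partner \<bar>fst c\<bar> 1 u v" using partner_exists by blast
    obtain u' v' where P': "partner \<bar>fst c\<bar> (- 1) u' v'" using partner_exists by blast
    have "sgn (fst c) \<in> {1, - 1}" using nd(4) by (auto simp: sgn_if)
    then obtain Q where Q: "vdir Q = sgn (fst c)" "hdir Q = 1"
      using quadrant_with_direction[of "sgn (fst c)" 1] by blast
    then have "side_curve c 1 \<subseteq> quadrant Q centre"
      using side_curve_subset_quadrant_iff[OF nd(2,3) P] P by (simp add: side_curve_def partner_point_eq)
    then have "hdir Q = - 1"
      using eq side_curve_subset_quadrant_iff[OF nd(2,3) P'] P' by (simp add: side_curve_def partner_point_eq)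
    then show False using Q by simp
  qed
  have pen: "e \<in> {1, - 1} \<Longrightarrow> hdir Q = e \<Longrightarrow> vdir Q = sgn (fst c) * e \<Longrightarrow> side_curve c e \<in> pencil centre Q" for e Q
    using side_curve_in_pencil[OF c] all by blast
  show ?thesis
  proof (cases "fst c > 0")
    case True
    then show ?thesis using adj ne pen[of 1 Q1] pen[of "- 1" Q3]
      by (intro exI[of _ "side_curve c 1"] exI[of _ "side_curve c (- 1)"]) (auto simp: vdir_def hdir_def)
  next
    case False
    then show ?thesis using nd(4) adj ne pen[of "- 1" Q2] pen[of 1 Q4]
      by (intro exI[of _ "side_curve c (- 1)"] exI[of _ "side_curve c 1"]) (auto simp: vdir_def hdir_def)
  qed
qed

text \<open>Only one vertical direction \<open>d\<close> stays in the square, and it forces the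
  horizontal direction \<open>sgn (fst c) * d\<close>.\<close>

lemma adjacent_curves_edge:
  assumes k: "k = 0 \<or> k = q" and c: "c \<in> nondominant_chains centre"
  shows "\<exists>C Q. adjacent_curves centre c = {C} \<and> C \<in> pencil centre Q"
proof -
  note nd = nondominantD[OF c]
  define d where "d = (if k = 0 then 1 else - 1 :: int)"
  define e where "e = sgn (fst c) * d"
  have e1: "e \<in> {1, - 1}" and d1: "d \<in> {1, - 1}" using nd(4) by (auto simp: e_def d_def sgn_if)
  have se: "sgn (fst c) * e = d" using nd(4) by (auto simp: e_def sgn_if)
  have "{e \<in> {1, - 1}. 0 \<le> k + sgn (fst c) * e \<and> k + sgn (fst c) * e \<le> q} = {e}"
    using k q_pos nd(4) by (auto simp: e_def d_def sgn_if)
  then have "adjacent_curves centre c = {side_curve c e}" using nondominant_adjacent_curves[OF c] by simp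
  moreover obtain Q where Q: "vdir Q = d" "hdir Q = e" using quadrant_with_direction[OF d1 e1] by blast
  then have "side_curve c e \<in> pencil centre Q"
    using side_curve_in_pencil[OF c e1 _ _ Q(2)] se k q_pos by (auto simp: d_def)
  ultimately show ?thesis by blast
qed

text \<open>On both edges the dominant chain of order \<open>q\<close> leaves the centre to the
  left, whence the uniform factor \<open>- 1\<close>; the bound \<open>1 \<le> p\<close> is what
  makes the pair a chain.\<close>

lemma dominant_edge_cases:
  assumes k: "k = 0 \<or> k = q" and dom: "dominant_chain s centre c"
  shows "fst c = 0 \<or> (fst c * p - snd c * q = k \<and> \<bar>fst c\<bar> = q \<and> sgn (fst c) * (- 1) = (if k = 0 then 1 else - 1) \<and> 1 \<le> p)"
  using k
proof
  assume "k = 0"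
  then show ?thesis using dom dominant_bottom_iff q_pos by (cases s) (auto simp: is_chain_def)
next
  assume "k = q"
  then show ?thesis using dom dominant_top_iff q_pos by (cases s) (auto simp: is_chain_def algebra_simps)
qed

text \<open>The only curve of a horizontal chain is the whole segment. The dominant chain of order
  \<open>q\<close> has the centre as an end-point, outside the relative interior of its segment, and
  a single curve adjacent to it.\<close>

lemma dominant_curves_on_edge:
  assumes k: "k = 0 \<or> k = q" and dom: "dominant_chain s centre c"
  shows "\<exists>C. dominant_curves_on centre c = {C} \<and>
     (centre \<in> rel_interior (segment c) \<longrightarrow> centre \<in> rel_interior C)"
proof (cases "fst c = 0")
  case True
  then show ?thesis using dominant_curves_on_horizontal[OF dom] by blast
next
  case False
  then have c: "fst c * p - snd c * q = k" "\<bar>fst c\<bar> = q" "sgn (fst c) * (- 1) = (if k = 0 then 1 else - 1)" "1 \<le> p"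
    using dominant_edge_cases[OF k dom] by auto
  have order: "q \<le> \<bar>fst c\<bar>" using c by simp
  have dir: "{e \<in> {1, - 1}. 0 \<le> k + sgn (fst c) * e \<and> k + sgn (fst c) * e \<le> q} = {- 1}"
    using k q_pos c(3) by (auto split: if_splits)
  have "adjacent_curves centre c = side_curve c ` {e \<in> {1, - 1}. 0 \<le> k + sgn (fst c) * e \<and> k + sgn (fst c) * e \<le> q}"
  proof (rule adjacent_curves_eq[OF c(1) order])
    fix e :: int assume "e \<in> {1, - 1}" "0 \<le> k + sgn (fst c) * e" "k + sgn (fst c) * e \<le> q"
    then have "e \<in> {e \<in> {1, - 1}. 0 \<le> k + sgn (fst c) * e \<and> k + sgn (fst c) * e \<le> q}" by blast
    then have "e = - 1" unfolding dir by simp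
    then show "0 \<le> p + e \<and> p + e \<le> q" using c(4) p_bounds by auto
  qed
  then have adj: "adjacent_curves centre c = {side_curve c (- 1)}" unfolding dir by simp
  have "end_point c centre"
    using k q_pos False c(1) on_chain_iff by (auto simp: end_point_def)
  then have "dominant_curves_on centre c = {side_curve c (- 1)}"
    using adj by (simp add: dominant_curves_on_def adjacent_curves_def)
  moreover have "centre \<notin> rel_interior (segment c)"
  proof
    assume ri: "centre \<in> rel_interior (segment c)"
    obtain u v where P: "partner \<bar>fst c\<bar> (- 1) u v" using partner_exists by blast
    define w where "w = chain_point c (of_int u / of_int v)"
    have w: "w \<in> segment c"
      unfolding w_def using k c p_bounds q_pos by (intro partner_point_in_segment[OF c(1) order P]) (auto split: if_splits)
    have "0 < of_int (- 1) * (of_int u / of_int v - abscissa)"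
      using partner_side[of "chain_order c" "- 1" u v] P order by simp
    then have "snd w \<noteq> snd centre" using height_diff[OF c(1) order, of "of_int u / of_int v"] False by (auto simp: w_def)
    \<comment> \<open>From a point of the relative interior the segment coming from \<open>w\<close>
      could be prolonged a little; here its height would pass below 0 or above 1.\<close>
    moreover obtain \<mu> where \<mu>: "\<mu> > 1" "(1 - \<mu>) *\<^sub>R w + \<mu> *\<^sub>R centre \<in> segment c"
      using ri w convex_rel_interior_iff[OF convex_segment, of c centre] by blast
    ultimately show False
    proof -
      have sw: "0 \<le> snd w" "snd w \<le> 1" using w by (auto simp: segment_def)
      have s: "0 \<le> (1 - \<mu>) * snd w + \<mu> * snd centre" "(1 - \<mu>) * snd w + \<mu> * snd centre \<le> 1"
      proof -
        have b: "0 \<le> snd z \<and> snd z \<le> 1" if "z \<in> segment c" for z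
          using that by (auto simp: segment_def)
        show "0 \<le> (1 - \<mu>) * snd w + \<mu> * snd centre" "(1 - \<mu>) * snd w + \<mu> * snd centre \<le> 1"
          using b[OF \<mu>(2)] by simp_all
      qed
      show False
      proof (cases "k = 0")
        case True
        then have "0 < snd w" using \<open>snd w \<noteq> snd centre\<close> sw by simp
        then show False using s(1) \<mu>(1) True by (simp add: zero_le_mult_iff)
      next
        case False
        then have "k = q" using k by simp
        then have z: "snd centre = 1" using q_pos by simp
        then have "0 < 1 - snd w" using \<open>snd w \<noteq> snd centre\<close> sw by simp
        then have "0 < (\<mu> - 1) * (1 - snd w)" using \<mu>(1) by simp
        then show False using s(2) unfolding z by (simp add: algebra_simps)
      qed
    qed
  qed
  ultimately show ?thesis by blast
qed

lemma dominant_chain_exists_edge: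
  assumes "k = 0 \<or> k = q" "0 < p" "p < q"
  shows "\<exists>c. dominant_chain s centre c"
  using assms(1)
proof
  assume "k = 0"
  then show ?thesis unfolding dominant_bottom_iff[OF \<open>k = 0\<close>] using assms
    by (cases s) (auto simp: is_chain_def)
next
  assume "k = q"
  then show ?thesis unfolding dominant_top_iff[OF \<open>k = q\<close>] using assms
    by (cases s) (auto simp: is_chain_def)
qed

lemma pencil_chain_sign:
  assumes "C \<in> pencil centre Q"
  shows "\<exists>c \<in> nondominant_chains centre. C \<in> critical_curves c \<and> chain_has_sign (quadrant_sign Q) c"
proof -
  obtain c where c: "c \<in> nondominant_chains centre" "C \<in> adjacent_curves centre c" "C \<subseteq> quadrant Q centre"
    using assms by (auto simp: pencil_def)
  then have "sgn (fst c) = vdir Q * hdir Q" using adjacent_in_quadrant_iff[OF c(1)] by blast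
  then show ?thesis using c chain_has_quadrant_sign unfolding adjacent_curves_def by blast
qed

section \<open>The one-to-one association of pencils and dominant curves\<close>

lemma dominant_curvesE:
  assumes "C \<in> dominant_curves z"
  obtains s c where "dominant_chain s z c" "C \<in> dominant_curves_on z c" "is_chain c" "C \<in> critical_curves c"
  using assms dominant_curves_on_critical by (auto simp: dominant_curves_def dominant_curves_of_def dominant_chain_def)

lemma pencil_neighbour_curve_unique:
  assumes ok: "quadrant_ok Q"
  shows "\<exists>!C. C \<in> (\<Union>z \<in> neighbours centre. dominant_curves z) \<and> pencil_in_curve centre Q C"
proof -
  define z where "z = (abscissa, of_int (k + vdir Q) / of_int q :: real)"
  obtain \<sigma> c C where C: "dominant_chain \<sigma> z c" "C \<in> dominant_curves_on z c" "pencil_in_curve centre Q C"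
    using pencil_dominating[OF ok] unfolding z_def by blast
  have z: "z \<in> neighbours centre"
    unfolding neighbours_iff z_def using ok vdir_cases[of Q] by (auto simp: quadrant_ok_def)
  have cc: "is_chain c" "C \<in> critical_curves c"
    using C dominant_curves_on_critical by (auto simp: dominant_chain_def)
  show ?thesis
  proof (rule ex1I[of _ C])
    show "C \<in> (\<Union>z \<in> neighbours centre. dominant_curves z) \<and> pencil_in_curve centre Q C"
      using z C unfolding dominant_curves_def dominant_curves_of_def by blast
  next
    fix C' assume "C' \<in> (\<Union>z \<in> neighbours centre. dominant_curves z) \<and> pencil_in_curve centre Q C'"
    then obtain z' where "C' \<in> dominant_curves z'" "pencil_in_curve centre Q C'" by blast
    then show "C' = C" using pencil_in_curve_unique(2)[OF ok _ _ cc _ C(3)] by (blast elim: dominant_curvesE)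
  qed
qed

text \<open>The neighbour gives \<open>vdir Q\<close>, and the sign of its dominant chain then gives
  \<open>hdir Q\<close>. Interior neighbours are singled out because several pencils pointing to an
  edge neighbour may share its horizontal curve.\<close>

lemma neighbour_curve_pencil_unique:
  assumes z: "z \<in> neighbours centre" "snd z \<notin> {0, 1}" and C: "C \<in> dominant_curves z"
  shows "\<exists>!Q. Q \<in> pencil_quadrants centre \<and> pencil_in_curve centre Q C"
proof -
  obtain d where d: "d \<in> {1, - 1}" "0 \<le> k + d" "k + d \<le> q" "z = (abscissa, of_int (k + d) / of_int q)"
    using z(1) neighbours_iff by blast
  interpret N: rational_critical p q "k + d"
    using d q_pos coprime_pq p_bounds by unfold_locales auto
  have int: "0 < k + d" "k + d < q" using z(2) d q_pos by (auto simp: le_less)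
  obtain s c where c: "dominant_chain s z c" "C \<in> dominant_curves_on z c" "is_chain c" "C \<in> critical_curves c"
    using dominant_curvesE[OF C] .
  have c': "fst c * p - snd c * q = k + d" "fst c \<noteq> 0"
    using c(1) unfolding d(4) N.dominant_interior_iff[OF int] by auto
  have sg: "sgn (fst c) * d \<in> {1, - 1}" using d(1) c'(2) by (auto simp: sgn_if)
  obtain Q where Q: "vdir Q = d" "hdir Q = sgn (fst c) * d" using quadrant_with_direction[OF d(1) sg] by blast
  have sQ: "sgn (fst c) = vdir Q * hdir Q" using Q d(1) by auto
  have ok: "quadrant_ok Q"
    using p_interior int d Q(1) hdir_cases[of Q] by (auto simp: quadrant_ok_def)
  obtain \<sigma> c2 C2 where c2: "dominant_chain \<sigma> z c2" "C2 \<in> dominant_curves_on z c2" "pencil_in_curve centre Q C2"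
    "fst c2 = 0 \<or> sgn (fst c2) = vdir Q * hdir Q" "fst c2 \<noteq> 0"
    using pencil_dominating[OF ok] int unfolding Q(1) d(4) by metis
  have "c2 = c" using N.dominant_chain_unique_interior[OF int, of \<sigma> c2 s c] c(1) c2 sQ unfolding d(4) by auto
  moreover obtain D where "dominant_curves_on z c = {D}"
    using N.dominant_curve_interior[OF int, of s c] c(1) unfolding d(4) by metis
  ultimately have "C2 = C" using c(2) c2(2) by simp
  show ?thesis
  proof (rule ex1I[of _ Q])
    show "Q \<in> pencil_quadrants centre \<and> pencil_in_curve centre Q C"
      using ok c2(3) \<open>C2 = C\<close> by (simp add: pencil_quadrants_eq)
  next
    fix Q' assume "Q' \<in> pencil_quadrants centre \<and> pencil_in_curve centre Q' C"
    then have Q': "quadrant_ok Q'" "pencil_in_curve centre Q' C" by (auto simp: pencil_quadrants_eq)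
    obtain \<sigma>' c3 C3 where c3: "dominant_chain \<sigma>' (abscissa, of_int (k + vdir Q') / of_int q) c3"
      "C3 \<in> dominant_curves_on (abscissa, of_int (k + vdir Q') / of_int q) c3" "pencil_in_curve centre Q' C3"
      "fst c3 * p - snd c3 * q = k + vdir Q'" "fst c3 = 0 \<or> sgn (fst c3) = vdir Q' * hdir Q'"
      using pencil_dominating[OF Q'(1)] by metis
    have "is_chain c3" "C3 \<in> critical_curves c3"
      using c3 dominant_curves_on_critical by (auto simp: dominant_chain_def)
    then have "c3 = c" using pencil_in_curve_unique(1)[OF Q'(1) _ _ c(3,4) c3(3) Q'(2)] by blast
    \<comment> \<open>The expression \<open>fst c * p - snd c * q\<close> recovers the ordinate of
      the neighbour from the chain, and so the vertical direction; the sign of the chain gives the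
      product of both directions.\<close>
    then have "vdir Q' = vdir Q" "vdir Q' * hdir Q' = vdir Q * hdir Q" using c3 c' Q(1) sQ by auto
    moreover from this have "hdir Q' = hdir Q" using vdir_cases[of Q] by auto
    ultimately show "Q' = Q" using quadrant_eqI by blast
  qed
qed

text \<open>A quadrant is recovered from \<open>vdir Q\<close>, which selects the neighbour, and
  \<open>quadrant_sign Q\<close>, which fixes \<open>vdir Q * hdir Q\<close>. A horizontal chain has
  both signs, so it can serve two pencils, but as a dominant chain it is labelled Positive at
  ordinate 0 and Negative at ordinate 1; hence the separate \<sigma>.\<close>

lemma pencil_neighbour_bijection:
  assumes p: "0 < p" "p < q"
  shows "\<exists>f. bij_betw f (pencil_quadrants centre) (neighbours centre \<times> (UNIV :: chain_sign set)) \<and>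
    (\<forall>Q \<in> pencil_quadrants centre. case f Q of (z, s) \<Rightarrow>
       \<exists>\<sigma> c. dominant_chain \<sigma> z c \<and> chain_has_sign s c \<and>
         (\<exists>C \<in> dominant_curves_on z c. pencil_in_curve centre Q C))"
proof -
  define f where "f = (\<lambda>Q. ((abscissa, of_int (k + vdir Q) / of_int q :: real), quadrant_sign Q))"
  have ok: "quadrant_ok Q \<longleftrightarrow> 0 \<le> k + vdir Q \<and> k + vdir Q \<le> q" for Q
    using p hdir_cases[of Q] by (auto simp: quadrant_ok_def)
  have "bij_betw f (pencil_quadrants centre) (neighbours centre \<times> UNIV)"
    unfolding bij_betw_def
  proof
    show "inj_on f (pencil_quadrants centre)"
    proof (rule inj_onI)
      fix Q Q' assume "f Q = f Q'"
      then have "real_of_int (k + vdir Q) / of_int q = of_int (k + vdir Q') / of_int q" "quadrant_sign Q = quadrant_sign Q'"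
        by (auto simp: f_def)
      then have v: "vdir Q = vdir Q'" "quadrant_sign Q = quadrant_sign Q'" using q_pos by auto
      then have "vdir Q * hdir Q = vdir Q' * hdir Q'"
        using vdir_cases[of Q] hdir_cases[of Q] hdir_cases[of Q'] by (auto simp: quadrant_sign_eq split: if_splits)
      then have "hdir Q = hdir Q'" using v(1) vdir_cases[of Q] by auto
      then show "Q = Q'" using v(1) quadrant_eqI by blast
    qed
    show "f ` pencil_quadrants centre = neighbours centre \<times> UNIV"
    proof (intro subset_antisym subsetI)
      fix y assume "y \<in> f ` pencil_quadrants centre"
      then obtain Q where "y = f Q" "0 \<le> k + vdir Q" "k + vdir Q \<le> q"
        by (auto simp: pencil_quadrants_eq ok)
      then show "y \<in> neighbours centre \<times> UNIV" using vdir_cases[of Q] by (auto simp: f_def neighbours_iff)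
    next
      fix y assume "y \<in> neighbours centre \<times> (UNIV :: chain_sign set)"
      then obtain z s where y: "y = (z, s)" "z \<in> neighbours centre" by auto
      then obtain d where d: "d \<in> {1, - 1}" "0 \<le> k + d" "k + d \<le> q" "z = (abscissa, of_int (k + d) / of_int q)"
        using neighbours_iff by blast
      define e where "e = (case s of Positive \<Rightarrow> d | Negative \<Rightarrow> - d)"
      have e: "e \<in> {1, - 1}" using d(1) by (cases s) (auto simp: e_def)
      obtain Q where Q: "vdir Q = d" "hdir Q = e" using quadrant_with_direction[OF d(1) e] by blast
      have "quadrant_sign Q = s" using Q d(1) by (cases s) (auto simp: quadrant_sign_eq e_def)
      then have "y = f Q" using y d(4) Q by (simp add: f_def)
      moreover have "Q \<in> pencil_quadrants centre" using d Q by (simp add: pencil_quadrants_eq ok)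
      ultimately show "y \<in> f ` pencil_quadrants centre" by blast
    qed
  qed
  moreover have "case f Q of (z, s) \<Rightarrow> \<exists>\<sigma> c. dominant_chain \<sigma> z c \<and> chain_has_sign s c \<and>
         (\<exists>C \<in> dominant_curves_on z c. pencil_in_curve centre Q C)" if "Q \<in> pencil_quadrants centre" for Q
  proof -
    have okQ: "quadrant_ok Q" using that by (simp add: pencil_quadrants_eq)
    obtain \<sigma> c C where c: "dominant_chain \<sigma> (abscissa, of_int (k + vdir Q) / of_int q) c"
      "C \<in> dominant_curves_on (abscissa, of_int (k + vdir Q) / of_int q) c" "pencil_in_curve centre Q C"
      "fst c = 0 \<or> sgn (fst c) = vdir Q * hdir Q"
      using pencil_dominating[OF okQ] by metis
    have "chain_has_sign (quadrant_sign Q) c"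
      using c(4)
    proof
      assume "fst c = 0"
      then show ?thesis by (cases "quadrant_sign Q") (auto simp: chain_has_sign_def)
    qed (rule chain_has_quadrant_sign)
    then show ?thesis unfolding f_def prod.case using c by blast
  qed
  ultimately show ?thesis by (intro exI[of _ f] conjI ballI)
qed

end

text \<open>The one-to-one association is spread over the last three clauses: from pencils to
  curves, from curves of interior neighbours back to pencils, and, for \<theta> different from 0 and
  1, as a bijection with signed neighbours, which also accounts for a horizontal curve shared by two
  pencils.\<close>

theorem theorem5:
  fixes \<zeta> :: point and \<theta> \<rho> :: real
  assumes "rational_critical_point \<zeta>" and "\<zeta> = (\<theta>, \<rho>)"
  shows
    "(\<rho> \<notin> {0, 1} \<longrightarrow>
       (\<forall>s. \<exists>C. dominant_curves_of s \<zeta> = {C} \<and> \<zeta> \<in> rel_interior C) \<and>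
       card (neighbours \<zeta>) = 2 \<and>
       pencil_quadrants \<zeta> = {Q1, Q2, Q3, Q4} \<and>
       (\<forall>c \<in> nondominant_chains \<zeta>. \<exists>C C'. C \<noteq> C' \<and> adjacent_curves \<zeta> c = {C, C'} \<and>
          (if fst c > 0 then C \<in> pencil \<zeta> Q1 \<and> C' \<in> pencil \<zeta> Q3
           else C \<in> pencil \<zeta> Q2 \<and> C' \<in> pencil \<zeta> Q4))) \<and>
     (\<rho> \<in> {0, 1} \<longrightarrow>
       (\<forall>s c. dominant_chain s \<zeta> c \<longrightarrow>
          (\<exists>C. dominant_curves_on \<zeta> c = {C} \<and>
               (\<zeta> \<in> rel_interior (segment c) \<longrightarrow> \<zeta> \<in> rel_interior C))) \<and>
       (\<theta> \<notin> {0, 1} \<longrightarrow> (\<forall>s. \<exists>c. dominant_chain s \<zeta> c)) \<and>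
       card (neighbours \<zeta>) = 1 \<and>
       (if \<theta> \<in> {0, 1} then \<exists>Q. pencil_quadrants \<zeta> = {Q}
        else \<exists>Q Q'. quadrant_sign Q \<noteq> quadrant_sign Q' \<and> pencil_quadrants \<zeta> = {Q, Q'}) \<and>
       (\<forall>c \<in> nondominant_chains \<zeta>. \<exists>C Q. adjacent_curves \<zeta> c = {C} \<and> C \<in> pencil \<zeta> Q)) \<and>
     (\<forall>Q \<in> pencil_quadrants \<zeta>. infinite (pencil \<zeta> Q)) \<and>
     (\<forall>c \<in> nondominant_chains \<zeta>. farey_point c \<zeta>) \<and>
     (\<forall>Q. \<forall>C \<in> pencil \<zeta> Q. \<exists>c \<in> nondominant_chains \<zeta>.
        C \<in> critical_curves c \<and> chain_has_sign (quadrant_sign Q) c) \<and>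
     (\<forall>Q \<in> pencil_quadrants \<zeta>. \<exists>!C.
        C \<in> (\<Union>z \<in> neighbours \<zeta>. dominant_curves z) \<and> pencil_in_curve \<zeta> Q C) \<and>
     (\<forall>z \<in> neighbours \<zeta>. snd z \<notin> {0, 1} \<longrightarrow>
        (\<forall>C \<in> dominant_curves z. \<exists>!Q. Q \<in> pencil_quadrants \<zeta> \<and> pencil_in_curve \<zeta> Q C)) \<and>
     (\<theta> \<notin> {0, 1} \<longrightarrow>
        (\<exists>f. bij_betw f (pencil_quadrants \<zeta>) (neighbours \<zeta> \<times> (UNIV :: chain_sign set)) \<and>
          (\<forall>Q \<in> pencil_quadrants \<zeta>. case f Q of (z, s) \<Rightarrow>
             \<exists>\<sigma> c. dominant_chain \<sigma> z c \<and> chain_has_sign s c \<and>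
               (\<exists>C \<in> dominant_curves_on z c. pencil_in_curve \<zeta> Q C))))"
proof -
  have rc: "\<theta> \<in> {0..1}" "\<rho> \<in> {0..1}" "\<theta> \<in> \<rat>" and "\<exists>i j :: int. of_int i * \<theta> = of_int j + \<rho>"
    using assms by (auto simp: rational_critical_point_def critical_point_def)
  then obtain i j :: int where ij: "of_int i * \<theta> = of_int j + \<rho>" by blast
  obtain p q where pq: "q > 0" "coprime p q" "\<theta> = of_int p / of_int q"
    using Rats_cases'[OF rc(3)] by metis
  \<comment> \<open>Inserting \<open>\<theta> = p / q\<close> into the equation of a critical point
    shows that \<open>q\<close> is also a denominator of \<rho>.\<close>
  define k where "k = i * p - j * q"
  have \<rho>: "\<rho> = of_int k / of_int q" using ij pq by (simp add: k_def field_simps)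
  interpret rational_critical p q k
  proof
    have "0 \<le> of_int p / (of_int q :: real)" "of_int p / (of_int q :: real) \<le> 1"
      "0 \<le> of_int k / (of_int q :: real)" "of_int k / (of_int q :: real) \<le> 1" using rc pq(3) \<rho> by auto
    then show "0 \<le> p" "p \<le> q" "0 \<le> k" "k \<le> q" using pq(1) by (simp_all add: zero_le_divide_iff)
  qed (use pq in auto)
  have \<zeta>: "\<zeta> = centre" using assms(2) pq(3) \<rho> by simp
  have \<rho>01: "\<rho> \<in> {0, 1} \<longleftrightarrow> k = 0 \<or> k = q" using q_pos \<rho> by auto
  have \<theta>01: "\<theta> \<in> {0, 1} \<longleftrightarrow> p = 0 \<or> p = q" using q_pos pq(3) by auto
  have farey: "\<forall>c \<in> nondominant_chains centre. farey_point c centre"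
    using nondominantD on_chain_iff abscissa_in_fractions_iff by (auto simp: farey_point_iff)
  show ?thesis
    unfolding \<zeta>
  proof (intro conjI impI)
    assume "\<rho> \<notin> {0, 1}"
    then have k: "0 < k" "k < q" using \<rho>01 k_bounds by auto
    show "\<forall>s. \<exists>C. dominant_curves_of s centre = {C} \<and> centre \<in> rel_interior C"
      using dominant_curves_of_interior[OF k] by blast
    show "card (neighbours centre) = 2" using card_neighbours(1)[OF k] .
    show "pencil_quadrants centre = {Q1, Q2, Q3, Q4}" using pencil_quadrants_interior[OF k] .
    show "\<forall>c \<in> nondominant_chains centre. \<exists>C C'. C \<noteq> C' \<and> adjacent_curves centre c = {C, C'} \<and>
          (if fst c > 0 then C \<in> pencil centre Q1 \<and> C' \<in> pencil centre Q3
           else C \<in> pencil centre Q2 \<and> C' \<in> pencil centre Q4)"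
      using adjacent_curves_interior[OF k] by blast
  next
    assume "\<rho> \<in> {0, 1}"
    then have k: "k = 0 \<or> k = q" using \<rho>01 by blast
    show "\<forall>s c. dominant_chain s centre c \<longrightarrow>
          (\<exists>C. dominant_curves_on centre c = {C} \<and>
               (centre \<in> rel_interior (segment c) \<longrightarrow> centre \<in> rel_interior C))"
      using dominant_curves_on_edge[OF k] by blast
    show "\<forall>s. \<exists>c. dominant_chain s centre c" if "\<theta> \<notin> {0, 1}"
      using dominant_chain_exists_edge[OF k] that \<theta>01 p_bounds by (simp add: le_less)
    show "card (neighbours centre) = 1" using card_neighbours(2)[OF k] .
    show "if \<theta> \<in> {0, 1} then \<exists>Q. pencil_quadrants centre = {Q}
        else \<exists>Q Q'. quadrant_sign Q \<noteq> quadrant_sign Q' \<and> pencil_quadrants centre = {Q, Q'}"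
      using pencil_quadrants_edge[OF k] pq(3) by simp
    show "\<forall>c \<in> nondominant_chains centre. \<exists>C Q. adjacent_curves centre c = {C} \<and> C \<in> pencil centre Q"
      using adjacent_curves_edge[OF k] by blast
  next
    show "\<forall>Q \<in> pencil_quadrants centre. infinite (pencil centre Q)"
      using infinite_pencil by (simp add: pencil_quadrants_eq)
    show "\<forall>c \<in> nondominant_chains centre. farey_point c centre" using farey .
    show "\<forall>Q. \<forall>C \<in> pencil centre Q. \<exists>c \<in> nondominant_chains centre.
        C \<in> critical_curves c \<and> chain_has_sign (quadrant_sign Q) c"
      using pencil_chain_sign by blast
    show "\<forall>Q \<in> pencil_quadrants centre. \<exists>!C.
        C \<in> (\<Union>z \<in> neighbours centre. dominant_curves z) \<and> pencil_in_curve centre Q C"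
      using pencil_neighbour_curve_unique by (simp add: pencil_quadrants_eq)
    show "\<forall>z \<in> neighbours centre. snd z \<notin> {0, 1} \<longrightarrow>
        (\<forall>C \<in> dominant_curves z. \<exists>!Q. Q \<in> pencil_quadrants centre \<and> pencil_in_curve centre Q C)"
      using neighbour_curve_pencil_unique by blast
  next
    assume "\<theta> \<notin> {0, 1}"
    then have "0 < p" "p < q" using \<theta>01 p_bounds by auto
    then show "\<exists>f. bij_betw f (pencil_quadrants centre) (neighbours centre \<times> (UNIV :: chain_sign set)) \<and>
          (\<forall>Q \<in> pencil_quadrants centre. case f Q of (z, s) \<Rightarrow>
             \<exists>\<sigma> c. dominant_chain \<sigma> z c \<and> chain_has_sign s c \<and>
               (\<exists>C \<in> dominant_curves_on z c. pencil_in_curve centre Q C))"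
      using pencil_neighbour_bijection by blast
  qed
qed

end
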